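(* (Virtual Kleber algorithm.) Let $(X,Y)$ be one of the pairs of affine types listed in the context, let $L=(L_i^{(a)})_{a\in\bar I^X,\,i\in\mathbb Z_{>0}}$ be nonnegative integers with finitely many nonzero (the multiplicities of $B^{a,i}$ in a tensor product $B$), and let $\lambda$ be a classical dominant weight for $X$. Let $\widehat T(B)$ be the tree produced by the virtual Kleber algorithm and $\gamma=\max_a\gamma_a$. Then there is a bijection between $C^v(B,\lambda)$ and the set of nodes $y$ of $\widehat T(B)$ of weight $\Psi(\lambda)$ that satisfy either of the following conditions: 1. $y$ is at depth $\ell$ with $\ell\in\gamma\mathbb Z$; or 2. $(d_{xy}\mid\bar\Lambda^Y_b)=0$ for all $b\in\iota(a)$ and every $a\in\bar I^X$ such that $1<\gamma=\gamma_a$, where $x$ is the parent of $y$.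
   Context: **Embeddings.** $I^X,I^Y$ are the sets of Dynkin nodes (0 the affine node), $\bar I=I\setminus\{0\}$. $\iota$ sends nodes of $X$ to orbits in $I^Y$ of a diagram automorphism $\sigma$ of $Y$ fixing $0$. The pairs, $\iota$ on $\bar I^X$, and factors $\gamma_a$, $a\in\bar I^X$, are: - $Y=A_{2n-1}^{(1)}$, $X=C_n^{(1)}$ ($n\ge2$), $A_{2n}^{(2)}$ ($n\ge1$), $A_{2n}^{(2)\dagger}$ ($n\ge1$), $D_{n+1}^{(2)}$ ($n\ge2$): $\iota(i)=\{i,2n-i\}$ ($1\le i<n$), $\iota(n)=\{n\}$; $\gamma_i=1$ for $1\le i\le n-1$, and $\gamma_n=2,2,1,1$ respectively. (In $A_{2n}^{(2)}$ the arrows of the Dynkin diagram point toward node $0$, in $A_{2n}^{(2)\dagger}$ away from node $0$.) - $Y=D_{n+1}^{(1)}$, $X=B_n^{(1)}$ ($n\ge3$), $A_{2n-1}^{(2)}$ ($n\ge2$): $\iota(i)=\{i\}$ ($i<n$), $\iota(n)=\{n,n+1\}$; for $B_n^{(1)}$, $\gamma_i=2$ ($i<n$), $\gamma_n=1$; for $A_{2n-1}^{(2)}$ all $\gamma_i=1$. (For $n=2$, $D_3^{(1)}$ is the diagram in which nodes $0$ and $1$ are each joined to $2$ and $3$, i.e. that of $A_3^{(1)}$ relabelled.) - $Y=E_6^{(1)}$ (nodes $1$–$2$–$3$–$4$–$5$ a chain, $3$–$6$–$0$), $X=F_4^{(1)},E_6^{(2)}$ (nodes $0,1,2,3,4$ in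 a chain, double bond between 2 and 3): $\iota(1)=\{6\}$, $\iota(2)=\{3\}$, $\iota(3)=\{2,4\}$, $\iota(4)=\{1,5\}$; for $F_4^{(1)}$ $\gamma_1=\gamma_2=2,\gamma_3=\gamma_4=1$; for $E_6^{(2)}$ all $\gamma_i=1$. - $Y=D_4^{(1)}$ (node $2$ central), $X=G_2^{(1)},D_4^{(3)}$ (nodes $0,1,2$ in a chain, triple bond between 1 and 2): $\iota(1)=\{2\}$, $\iota(2)=\{1,3,4\}$; for $G_2^{(1)}$ $\gamma_1=3,\gamma_2=1$; for $D_4^{(3)}$ all $\gamma_i=1$. Put $\Psi(\bar\Lambda^X_a)=\gamma_a\sum_{b\in\iota(a)}\bar\Lambda_b^Y$, extended linearly to classical weights. Define $\widehat L=(\widehat L_j^{(b)})$, $b\in\bar I^Y$ (the multiplicities of the factors $B_Y^{b,j}$ in the $Y$-crystal corresponding to $B$), by $\widehat L_{\gamma_ai}^{(b)}=L_i^{(a)}$ for $b\in\iota(a)$ and $\widehat L_j^{(b)}=0$ for $j\notin\gamma_a\mathbb Z$, except that for $X=A_{2n}^{(2)}$, $a=n$: $\widehat L_i^{(n)}=2L_i^{(n)}$ for all $i$. **Configurations in type $Y$.** Let $\bar P^+$ be the classical dominant weights of $Y$, $\bar Q^+$ the nonnegative integer span of the classical simple roots $\alpha_b$, $(\cdot|\cdot)$ the invariant form with $(\alpha_b|\alpha_b)=2$ (so $(\alpha_b|\bar\Lambda_c)=\delta_{bc}$), and $\mu\trianglerighteq\tau$ mean $\mu-\tau\in\bar Q^+$.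 $C^v(B,\lambda)$ is the set of matrices $\widehat\nu=(\widehat m_i^{(b)})_{b\in\bar I^Y,i\ge1}$ of nonnegative integers (finitely many nonzero) with: $\sum_{b,i}i\,\widehat m_i^{(b)}\alpha_b=\sum_{b,i}i\,\widehat L_i^{(b)}\bar\Lambda_b-\Psi(\lambda)$; $\widehat p_i^{(b)}:=\sum_{k\ge1}\min(i,k)\big(\widehat L_k^{(b)}-\sum_{c\in\bar I^Y}(\alpha_b|\alpha_c)\widehat m_k^{(c)}\big)\ge0$ for all $b,i$; $\widehat m_i^{(b)}=\widehat m_i^{(b')}$ whenever $b,b'$ lie in the same $\sigma$-orbit; and $\widehat m_j^{(b)}=0$ for $a\in\bar I^X$, $b\in\iota(a)$ and $j\notin\gamma_a\mathbb Z$. **Virtual Kleber algorithm.** It builds a rooted tree whose nodes $x$ carry weights $\mathrm{wt}(x)\in\bar P^+$; for an edge from $x$ to its child $y$, $d_{xy}=\mathrm{wt}(x)-\mathrm{wt}(y)\in\bar Q^+\setminus\{0\}$. 1. Let $T_0$ be a single node of weight $0$; set $\ell=0$. 2. Add $1$ to $\ell$. 3. Let $T'_\ell$ be obtained from $T_{\ell-1}$ by adding $\sum_{b\in\bar I^Y}\bar\Lambda_b\sum_{i\ge\ell}\widehat L_i^{(b)}$ to the weight of each node. 4. Let $T_\ell$ be obtained from $T'_\ell$ as follows: for each node $x$ at depth $\ell-1$, of weight $\mu$, and each $\tau\in\bar P^+$ with $\tau\ne\mu$ and $\mu\trianglerighteq\tau$, attach to $x$ a child $y$ of weight $\tau$ provided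 that: (i) if $x$ is not the root, with parent $w$, then $d_{wx}\trianglerighteq d_{xy}$; (ii) $(\tau\mid\alpha_b)=(\tau\mid\alpha_{b'})$ whenever $b,b'$ are in the same $\sigma$-orbit; (iii) for every $a\in\bar I^X$ with $\ell-1\notin\gamma_a\mathbb Z$ and every $b\in\iota(a)$, $(d_{wx}\mid\bar\Lambda_b)=(d_{xy}\mid\bar\Lambda_b)$, where $w$ is the parent of $x$. 5. If $T_\ell\ne T_{\ell-1}$ go to step 2; otherwise set $\widehat T(B)=T_\ell$ and stop. *)

theory Defs
  imports Complex_Main "HOL-Library.Groups_Big_Fun"
begin

section \<open>Affine types, Dynkin nodes and embeddings\<close>

text \<open>The types \<open>X\<close>; they determine \<open>Y\<close>. With the rank parameter \<open>n\<close> they are, in order,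
  \<open>C_n^(1)\<close>, \<open>A_{2n}^(2)\<close>, \<open>A_{2n}^(2)\<dagger>\<close>, \<open>D_{n+1}^(2)\<close>, \<open>B_n^(1)\<close>, \<open>A_{2n-1}^(2)\<close>,
  \<open>F_4^(1)\<close>, \<open>E_6^(2)\<close>, \<open>G_2^(1)\<close>, \<open>D_4^(3)\<close>.\<close>

datatype xtype =
    C1 nat | A2_even nat | A2_even_dagger nat | D2 nat
  | B1 nat | A2_odd nat
  | F4_1 | E6_2
  | G2_1 | D4_3

text \<open>The types \<open>Y\<close>: \<open>A_m^(1)\<close>, \<open>D_m^(1)\<close> and \<open>E_6^(1)\<close>, where \<open>m\<close> is the classical rank.\<close>

datatype ytype = A1 nat | D1 nat | E6_1

fun valid_X :: "xtype \<Rightarrow> bool" where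
  "valid_X (C1 n) \<longleftrightarrow> n \<ge> 2"
| "valid_X (A2_even n) \<longleftrightarrow> n \<ge> 1"
| "valid_X (A2_even_dagger n) \<longleftrightarrow> n \<ge> 1"
| "valid_X (D2 n) \<longleftrightarrow> n \<ge> 2"
| "valid_X (B1 n) \<longleftrightarrow> n \<ge> 3"
| "valid_X (A2_odd n) \<longleftrightarrow> n \<ge> 2"
| "valid_X F4_1 \<longleftrightarrow> True"
| "valid_X E6_2 \<longleftrightarrow> True"
| "valid_X G2_1 \<longleftrightarrow> True"
| "valid_X D4_3 \<longleftrightarrow> True"

fun Y_of :: "xtype \<Rightarrow> ytype" where
  "Y_of (C1 n) = A1 (2 * n - 1)"
| "Y_of (A2_even n) = A1 (2 * n - 1)"
| "Y_of (A2_even_dagger n) = A1 (2 * n - 1)"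
| "Y_of (D2 n) = A1 (2 * n - 1)"
| "Y_of (B1 n) = D1 (n + 1)"
| "Y_of (A2_odd n) = D1 (n + 1)"
| "Y_of F4_1 = E6_1"
| "Y_of E6_2 = E6_1"
| "Y_of G2_1 = D1 4"
| "Y_of D4_3 = D1 4"

fun rank_X :: "xtype \<Rightarrow> nat" where
  "rank_X (C1 n) = n"
| "rank_X (A2_even n) = n"
| "rank_X (A2_even_dagger n) = n"
| "rank_X (D2 n) = n"
| "rank_X (B1 n) = n"
| "rank_X (A2_odd n) = n"
| "rank_X F4_1 = 4"
| "rank_X E6_2 = 4"
| "rank_X G2_1 = 2"
| "rank_X D4_3 = 2"

fun rank_Y :: "ytype \<Rightarrow> nat" where
  "rank_Y (A1 m) = m"
| "rank_Y (D1 m) = m"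
| "rank_Y E6_1 = 6"

definition nodes_X :: "xtype \<Rightarrow> nat set" where "nodes_X X = {0..rank_X X}"
definition nodes_Y :: "ytype \<Rightarrow> nat set" where "nodes_Y Y = {0..rank_Y Y}"

definition cnodes_X :: "xtype \<Rightarrow> nat set" where "cnodes_X X = nodes_X X - {0}"
definition cnodes_Y :: "ytype \<Rightarrow> nat set" where "cnodes_Y Y = nodes_Y Y - {0}"

text \<open>Edges \<open>{i, j}\<close> with \<open>i < j\<close> of the affine diagrams of types D and E. The last clause for D
  adds, for \<open>D_3^(1)\<close> only, the second edge at node \<open>0\<close>.\<close>

definition D_edge :: "nat \<Rightarrow> nat \<Rightarrow> nat \<Rightarrow> bool" where
  "D_edge m i j \<longleftrightarrow>
     (1 \<le> i \<and> i \<le> m - 2 \<and> j = i + 1) \<or> (i = m - 2 \<and> j = m) \<or> (i = 0 \<and> j = 2)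
     \<or> (m = 3 \<and> i = 0 \<and> j = 3)"

definition E6_edge :: "nat \<Rightarrow> nat \<Rightarrow> bool" where
  "E6_edge i j \<longleftrightarrow> (i, j) \<in> {(1,2), (2,3), (3,4), (4,5), (3,6), (0,6)}"

text \<open>The affine Cartan matrix of \<open>Y\<close>, on \<open>nodes_Y Y\<close>. The formula for \<open>A_m^(1)\<close> gives
  off-diagonal entries \<open>-2\<close> when \<open>m = 1\<close>.\<close>

fun cartan :: "ytype \<Rightarrow> nat \<Rightarrow> nat \<Rightarrow> int" where
  "cartan (A1 m) i j =
     2 * of_bool (i = j) - of_bool (j = (i + 1) mod (m + 1)) - of_bool (i = (j + 1) mod (m + 1))"
| "cartan (D1 m) i j =
     2 * of_bool (i = j) - of_bool (D_edge m i j \<or> D_edge m j i)"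
| "cartan E6_1 i j =
     2 * of_bool (i = j) - of_bool (E6_edge i j \<or> E6_edge j i)"

text \<open>The diagram automorphism \<open>\<sigma>\<close> of \<open>Y\<close>; all types on a common \<open>Y\<close> share it except that on
  \<open>D_4^(1)\<close> the types \<open>G_2^(1)\<close>, \<open>D_4^(3)\<close> use the triality.\<close>

fun sigma :: "xtype \<Rightarrow> nat \<Rightarrow> nat" where
  "sigma (C1 n) i = (if i = 0 then 0 else 2 * n - i)"
| "sigma (A2_even n) i = (if i = 0 then 0 else 2 * n - i)"
| "sigma (A2_even_dagger n) i = (if i = 0 then 0 else 2 * n - i)"
| "sigma (D2 n) i = (if i = 0 then 0 else 2 * n - i)"
| "sigma (B1 n) i = (if i = n then n + 1 else if i = n + 1 then n else i)"
| "sigma (A2_odd n) i = (if i = n then n + 1 else if i = n + 1 then n else i)"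
| "sigma F4_1 i = (if 1 \<le> i \<and> i \<le> 5 then 6 - i else i)"
| "sigma E6_2 i = (if 1 \<le> i \<and> i \<le> 5 then 6 - i else i)"
| "sigma G2_1 i = (if i = 1 then 3 else if i = 3 then 4 else if i = 4 then 1 else i)"
| "sigma D4_3 i = (if i = 1 then 3 else if i = 3 then 4 else if i = 4 then 1 else i)"

definition same_orbit :: "xtype \<Rightarrow> nat \<Rightarrow> nat \<Rightarrow> bool" where
  "same_orbit X b b' \<longleftrightarrow> (\<exists>k. b' = (sigma X ^^ k) b)"

text \<open>\<open>\<iota>\<close> and the scaling factors \<open>\<gamma>\<^sub>a\<close>; both are meant for arguments in \<open>cnodes_X X\<close>.\<close>

fun iota :: "xtype \<Rightarrow> nat \<Rightarrow> nat set" where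
  "iota (C1 n) a = (if a < n then {a, 2 * n - a} else {n})"
| "iota (A2_even n) a = (if a < n then {a, 2 * n - a} else {n})"
| "iota (A2_even_dagger n) a = (if a < n then {a, 2 * n - a} else {n})"
| "iota (D2 n) a = (if a < n then {a, 2 * n - a} else {n})"
| "iota (B1 n) a = (if a < n then {a} else {n, n + 1})"
| "iota (A2_odd n) a = (if a < n then {a} else {n, n + 1})"
| "iota F4_1 a = (if a = 1 then {6} else if a = 2 then {3} else if a = 3 then {2, 4} else {1, 5})"
| "iota E6_2 a = (if a = 1 then {6} else if a = 2 then {3} else if a = 3 then {2, 4} else {1, 5})"
| "iota G2_1 a = (if a = 1 then {2} else {1, 3, 4})"
| "iota D4_3 a = (if a = 1 then {2} else {1, 3, 4})"

fun gam :: "xtype \<Rightarrow> nat \<Rightarrow> nat" where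
  "gam (C1 n) a = (if a = n then 2 else 1)"
| "gam (A2_even n) a = (if a = n then 2 else 1)"
| "gam (A2_even_dagger n) a = 1"
| "gam (D2 n) a = 1"
| "gam (B1 n) a = (if a < n then 2 else 1)"
| "gam (A2_odd n) a = 1"
| "gam F4_1 a = (if a = 1 \<or> a = 2 then 2 else 1)"
| "gam E6_2 a = 1"
| "gam G2_1 a = (if a = 1 then 3 else 1)"
| "gam D4_3 a = 1"

definition gam_max :: "xtype \<Rightarrow> nat" where
  "gam_max X = Max (gam X ` cnodes_X X)"

section \<open>Classical weights of Y\<close>

text \<open>An element of the real span of the classical weights of \<open>Y\<close> is given by its coordinates in
  the basis of simple roots, extended by zero outside \<open>cnodes_Y Y\<close>.\<close>

type_synonym weight = "nat \<Rightarrow> real"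

definition weight_space :: "ytype \<Rightarrow> weight set" where
  "weight_space Y = {\<mu>. \<forall>c. c \<notin> cnodes_Y Y \<longrightarrow> \<mu> c = 0}"

definition wminus :: "weight \<Rightarrow> weight \<Rightarrow> weight" where
  "wminus \<mu> \<nu> = (\<lambda>c. \<mu> c - \<nu> c)"

definition lincomb :: "ytype \<Rightarrow> (nat \<Rightarrow> real) \<Rightarrow> (nat \<Rightarrow> weight) \<Rightarrow> weight" where
  "lincomb Y k v = (\<lambda>c. \<Sum>b\<in>cnodes_Y Y. k b * v b c)"

definition simple_root :: "nat \<Rightarrow> weight" where
  "simple_root b = (\<lambda>c. of_bool (c = b))"

text \<open>The invariant form, which for simply-laced \<open>Y\<close> satisfies \<open>(\<alpha>\<^sub>b|\<alpha>\<^sub>c) = cartan Y b c\<close>.\<close>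

definition inv_form :: "ytype \<Rightarrow> weight \<Rightarrow> weight \<Rightarrow> real" where
  "inv_form Y \<mu> \<nu> =
     (\<Sum>b\<in>cnodes_Y Y. \<Sum>c\<in>cnodes_Y Y. \<mu> b * real_of_int (cartan Y b c) * \<nu> c)"

definition fund :: "ytype \<Rightarrow> nat \<Rightarrow> weight" where
  "fund Y c = (THE \<mu>. \<mu> \<in> weight_space Y \<and>
     (\<forall>b\<in>cnodes_Y Y. inv_form Y (simple_root b) \<mu> = of_bool (b = c)))"

definition dominant :: "ytype \<Rightarrow> weight set" where
  "dominant Y = {lincomb Y (\<lambda>b. real (k b)) (fund Y) | k :: nat \<Rightarrow> nat. True}"

definition root_cone :: "ytype \<Rightarrow> weight set" where
  "root_cone Y = {lincomb Y (\<lambda>b. real (k b)) simple_root | k :: nat \<Rightarrow> nat. True}"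

definition dominates :: "ytype \<Rightarrow> weight \<Rightarrow> weight \<Rightarrow> bool" where
  "dominates Y \<mu> \<tau> \<longleftrightarrow> wminus \<mu> \<tau> \<in> root_cone Y"

section \<open>Weights of X, the map Psi and the multiplicities in type Y\<close>

text \<open>A classical weight of \<open>X\<close> is given by its coefficients in the fundamental weights of \<open>X\<close>.\<close>

definition dominant_X :: "xtype \<Rightarrow> (nat \<Rightarrow> int) set" where
  "dominant_X X = {lam. (\<forall>a\<in>cnodes_X X. 0 \<le> lam a) \<and> (\<forall>a. a \<notin> cnodes_X X \<longrightarrow> lam a = 0)}"

definition Psi :: "xtype \<Rightarrow> (nat \<Rightarrow> int) \<Rightarrow> weight" where
  "Psi X lam = (\<lambda>c. \<Sum>a\<in>cnodes_X X.
     real_of_int (lam a) * (real (gam X a) * (\<Sum>b\<in>iota X a. fund (Y_of X) b c)))"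

definition iota_index :: "xtype \<Rightarrow> nat \<Rightarrow> nat" where
  "iota_index X b = (THE a. a \<in> cnodes_X X \<and> b \<in> iota X a)"

text \<open>\<open>L a i\<close> is the multiplicity of \<open>B^{a,i}\<close> in \<open>B\<close>. \<open>Lhat X L b j\<close> is meant for
  \<open>b \<in> cnodes_Y (Y_of X)\<close> and \<open>j \<ge> 1\<close>.\<close>

definition Lhat :: "xtype \<Rightarrow> (nat \<Rightarrow> nat \<Rightarrow> nat) \<Rightarrow> nat \<Rightarrow> nat \<Rightarrow> nat" where
  "Lhat X L b j =
     (let a = iota_index X b in
      if X = A2_even (rank_X X) \<and> a = rank_X X then 2 * L a j
      else if gam X a dvd j then L a (j div gam X a)
      else 0)"

section \<open>Virtual configurations\<close>

text \<open>Below \<open>Sum_any\<close> sums over all natural numbers; index \<open>0\<close> contributes nothing, because of the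
  factor \<open>i\<close> or \<open>min i k\<close>, so these are the sums over positive indices.\<close>

definition vacancy :: "xtype \<Rightarrow> (nat \<Rightarrow> nat \<Rightarrow> nat) \<Rightarrow> (nat \<Rightarrow> nat \<Rightarrow> nat) \<Rightarrow> nat \<Rightarrow> nat \<Rightarrow> real" where
  "vacancy X L m b i =
     Sum_any (\<lambda>k. real (min i k) *
       (real (Lhat X L b k) -
        (\<Sum>c\<in>cnodes_Y (Y_of X).
           inv_form (Y_of X) (simple_root b) (simple_root c) * real (m c k))))"

text \<open>A configuration is a matrix \<open>m b i\<close> extended by zero outside \<open>b \<in> cnodes_Y\<close>, \<open>i \<ge> 1\<close>.\<close>

definition virtual_configs ::
    "xtype \<Rightarrow> (nat \<Rightarrow> nat \<Rightarrow> nat) \<Rightarrow> (nat \<Rightarrow> int) \<Rightarrow> (nat \<Rightarrow> nat \<Rightarrow> nat) set" where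
  "virtual_configs X L lam = {m.
     (\<forall>b i. b \<notin> cnodes_Y (Y_of X) \<or> i = 0 \<longrightarrow> m b i = 0) \<and>
     finite {(b, i). m b i \<noteq> 0} \<and>
     lincomb (Y_of X) (\<lambda>b. Sum_any (\<lambda>i. real i * real (m b i))) simple_root =
       wminus (lincomb (Y_of X) (\<lambda>b. Sum_any (\<lambda>i. real i * real (Lhat X L b i))) (fund (Y_of X)))
              (Psi X lam) \<and>
     (\<forall>b\<in>cnodes_Y (Y_of X). \<forall>i\<ge>1. 0 \<le> vacancy X L m b i) \<and>
     (\<forall>b\<in>cnodes_Y (Y_of X). \<forall>b'\<in>cnodes_Y (Y_of X). \<forall>i\<ge>1.
        same_orbit X b b' \<longrightarrow> m b i = m b' i) \<and>
     (\<forall>a\<in>cnodes_X X. \<forall>b\<in>iota X a. \<forall>j\<ge>1. \<not> gam X a dvd j \<longrightarrow> m b j = 0)}"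

section \<open>The virtual Kleber algorithm\<close>

text \<open>A weighted rooted tree is a partial map from node names to weights. The name of a node lists,
  from the root \<open>[]\<close> downwards, the weights which the nodes on the path had when they were attached;
  hence depth is \<open>length\<close>, parent is \<open>butlast\<close>, and the name stays fixed while step 3 changes
  the weight.\<close>

type_synonym wtree = "weight list \<rightharpoonup> weight"

definition wt :: "wtree \<Rightarrow> weight list \<Rightarrow> weight" where
  "wt T x = the (T x)"

definition edge_diff :: "wtree \<Rightarrow> weight list \<Rightarrow> weight list \<Rightarrow> weight" where
  "edge_diff T x y = wminus (wt T x) (wt T y)"

definition initial_tree :: wtree where
  "initial_tree = [[] \<mapsto> (\<lambda>_. 0)]"

definition added_weight :: "xtype \<Rightarrow> (nat \<Rightarrow> nat \<Rightarrow> nat) \<Rightarrow> nat \<Rightarrow> weight" where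
  "added_weight X L l =
     lincomb (Y_of X) (\<lambda>b. Sum_any (\<lambda>i. if l \<le> i then real (Lhat X L b i) else 0)) (fund (Y_of X))"

definition shift_tree :: "xtype \<Rightarrow> (nat \<Rightarrow> nat \<Rightarrow> nat) \<Rightarrow> nat \<Rightarrow> wtree \<Rightarrow> wtree" where
  "shift_tree X L l T = (\<lambda>x. map_option (\<lambda>\<mu> c. \<mu> c + added_weight X L l c) (T x))"

text \<open>\<open>may_attach X l T x \<tau>\<close>: in step 4 of round \<open>l\<close>, a child of weight \<open>\<tau>\<close> is attached to the
  node \<open>x\<close> of \<open>T = T'\<^sub>l\<close>. For \<open>x = []\<close> one has \<open>l = 1\<close>, and condition (iii) is vacuous.\<close>

definition may_attach :: "xtype \<Rightarrow> nat \<Rightarrow> wtree \<Rightarrow> weight list \<Rightarrow> weight \<Rightarrow> bool" where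
  "may_attach X l T x \<tau> \<longleftrightarrow>
     (let Y = Y_of X; w = butlast x; d_wx = edge_diff T w x; d_xy = wminus (wt T x) \<tau> in
      x \<in> dom T \<and> length x = l - 1 \<and>
      \<tau> \<in> dominant Y \<and> \<tau> \<noteq> wt T x \<and> dominates Y (wt T x) \<tau> \<and>
      (x \<noteq> [] \<longrightarrow> dominates Y d_wx d_xy) \<and>
      (\<forall>b\<in>cnodes_Y Y. \<forall>b'\<in>cnodes_Y Y. same_orbit X b b' \<longrightarrow>
         inv_form Y \<tau> (simple_root b) = inv_form Y \<tau> (simple_root b')) \<and>
      (\<forall>a\<in>cnodes_X X. \<not> gam X a dvd (l - 1) \<longrightarrow>
         (\<forall>b\<in>iota X a. inv_form Y d_wx (fund Y b) = inv_form Y d_xy (fund Y b))))"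

definition attach_children :: "xtype \<Rightarrow> nat \<Rightarrow> wtree \<Rightarrow> wtree" where
  "attach_children X l T =
     (\<lambda>y. if y \<noteq> [] \<and> may_attach X l T (butlast y) (last y) then Some (last y) else T y)"

primrec kleber_tree :: "xtype \<Rightarrow> (nat \<Rightarrow> nat \<Rightarrow> nat) \<Rightarrow> nat \<Rightarrow> wtree" where
  "kleber_tree X L 0 = initial_tree"
| "kleber_tree X L (Suc l) = attach_children X (Suc l) (shift_tree X L (Suc l) (kleber_tree X L l))"

text \<open>The output: the tree of the first round \<open>l \<ge> 1\<close> that changed nothing.\<close>

definition final_tree :: "xtype \<Rightarrow> (nat \<Rightarrow> nat \<Rightarrow> nat) \<Rightarrow> wtree" where
  "final_tree X L =
     kleber_tree X L (LEAST l. l \<ge> 1 \<and> kleber_tree X L l = kleber_tree X L (l - 1))"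

text \<open>The two conditions on a node \<open>y\<close> of the tree; the root (depth \<open>0\<close>) satisfies the first one.\<close>

definition good_depth :: "xtype \<Rightarrow> weight list \<Rightarrow> bool" where
  "good_depth X y \<longleftrightarrow> gam_max X dvd length y"

definition good_edge :: "xtype \<Rightarrow> wtree \<Rightarrow> weight list \<Rightarrow> bool" where
  "good_edge X T y \<longleftrightarrow> y \<noteq> [] \<and>
     (\<forall>a\<in>cnodes_X X. 1 < gam_max X \<and> gam_max X = gam X a \<longrightarrow>
        (\<forall>b\<in>iota X a. inv_form (Y_of X) (edge_diff T (butlast y) y) (fund (Y_of X) b) = 0))"

end

theory Submission
  imports Defs
begin

text \<open>A configuration \<open>m\<close> assigns to each classical node \<open>b\<close> of \<open>Y\<close> a partition having \<open>m b i\<close> rows of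
  length \<open>i\<close>. Reading these partitions by columns gives, for each \<open>j \<ge> 1\<close>, the element
  \<open>d\<^sub>j = (\<Sum>b. (\<Sum>i\<ge>j. m b i) \<alpha>\<^sub>b)\<close> of the root cone, and the \<open>d\<^sub>j\<close> are the edge labels of a branch
  of the tree: the corresponding node lies at depth \<open>n\<close>, the number of nonzero columns, and
  the \<open>j\<close>-th edge on the way to it from the root has label \<open>d\<^sub>j\<close>. The rules of the algorithm are exactly the
  conditions on \<open>m\<close> read off in these coordinates. Write \<open>A\<^sub>j\<close> for the weight added in round \<open>j\<close>.

  \<^item> Successive differences \<open>d\<^sub>j - d\<^sub>j\<^sub>+\<^sub>1\<close> have the coefficients \<open>m b j\<close>, so rule (i) says that these
    are nonnegative integers.
  \<^item> The weight at depth \<open>j\<close> is \<open>\<Sum>i\<le>j. A\<^sub>i - d\<^sub>i\<close>, and its pairing with \<open>\<alpha>\<^sub>b\<close> is the vacancy number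
    \<open>p\<^sub>j\<close> at \<open>b\<close> (lemma \<open>vacancy_eq\<close>, an Abel summation). Dominance along the branch
    therefore is nonnegativity of the vacancy numbers up to \<open>n\<close>, and beyond \<open>n\<close> they only grow
    (\<open>represents_dominant_iff\<close>).
  \<^item> \<open>\<sigma>\<close> preserves the Cartan matrix, which is invertible, so all weights along the branch are
    \<open>\<sigma>\<close>-invariant if and only if all \<open>d\<^sub>j\<close> are, i.e. if and only if \<open>m\<close> is
    (\<open>represents_symmetric_iff\<close>).
  \<^item> Rule (iii) at depth \<open>j + 1\<close> says \<open>m b j = 0\<close> when \<open>\<gamma>\<^sub>a\<close> does not divide \<open>j\<close>. It is imposed for
    \<open>j < n\<close> only; the missing case \<open>j = n\<close>, where \<open>m b n\<close> is the coefficient of \<open>d\<^sub>n\<close>, is the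
    selection condition in the theorem, since every \<open>\<gamma>\<^sub>a\<close> is \<open>1\<close> or \<open>\<gamma>\<close>
    (\<open>represents_divisible_iff\<close>).

  Two facts make the output of the algorithm equal to the set of all such branches. The tree
  after \<open>l\<close> rounds has a closed form (\<open>kleber_tree_eq\<close>). Moreover the algorithm stops, and stops
  only when nothing can change any more (\<open>final_tree_stable\<close>): pairing with \<open>2\<rho>\<close> shows that a
  dominant weight has nonnegative height, while every edge lowers the height by at least one.
  The same vector \<open>2\<rho>\<close>, having positive coordinates and positive pairings with the simple roots,
  shows that the Cartan matrix is an invertible M-matrix, so that fundamental weights exist.\<close>

section \<open>Cartan matrices, diagram automorphisms and embeddings\<close>

lemma finite_cnodes_Y: "finite (cnodes_Y Y)" and finite_cnodes_X: "finite (cnodes_X X)"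
  by (auto simp: cnodes_Y_def nodes_Y_def cnodes_X_def nodes_X_def)

lemma cnodes_Y_eq: "cnodes_Y Y = {1..rank_Y Y}"
  by (auto simp: cnodes_Y_def nodes_Y_def)

lemma cnodes_X_eq: "cnodes_X X = {1..rank_X X}"
  by (auto simp: cnodes_X_def nodes_X_def)

lemma cartan_sym: "cartan Y b c = cartan Y c b"
  by (cases Y) (auto simp: of_bool_def)

lemma cartan_offdiag: "b \<noteq> c \<Longrightarrow> cartan Y b c \<le> 0"
  by (cases Y) (auto simp: of_bool_def)

lemma cartan_A_classical:
  assumes "b \<in> {1..m}" "c \<in> {1..m}"
  shows "cartan (A1 m) b c = 2 * of_bool (b = c) - of_bool (c = b + 1 \<or> b = c + 1)"
proof -
  have "c = (b + 1) mod (m + 1) \<longleftrightarrow> c = b + 1"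
    using assms by (cases "b = m") auto
  moreover have "b = (c + 1) mod (m + 1) \<longleftrightarrow> b = c + 1"
    using assms by (cases "c = m") auto
  ultimately show ?thesis
    by (auto simp: of_bool_def)
qed

lemma sum_neighbours:
  fixes r :: "nat \<Rightarrow> real"
  assumes "finite S" "b \<in> S" "nb \<subseteq> S"
    and "\<And>c. c \<in> S \<Longrightarrow> C c = 2 * of_bool (b = c) - (of_bool (c \<in> nb) :: int)"
  shows "(\<Sum>c\<in>S. real_of_int (C c) * r c) = 2 * r b - (\<Sum>c\<in>nb. r c)"
proof -
  have "(\<Sum>c\<in>S. real_of_int (C c) * r c)
      = (\<Sum>c\<in>S. (if b = c then 2 * r c else 0) - (if c \<in> nb then r c else 0))"
    by (rule sum.cong) (auto simp: assms(4))
  also have "\<dots> = 2 * r b - (\<Sum>c\<in>S \<inter> nb. r c)"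
    using assms(1,2) by (simp add: sum_subtractf sum.inter_restrict sum.delta)
  also have "S \<inter> nb = nb" using assms(3) by blast
  finally show ?thesis .
qed

text \<open>The coordinates \<open>c (m + 1 - c)\<close> of \<open>2\<rho>\<close> vanish at \<open>c = 0\<close> and \<open>c = m + 1\<close>, which is why
  the end nodes, although each lacks a neighbour, satisfy the same identity as the others.\<close>

lemma two_rho_A:
  assumes "b \<in> {1..m}"
  shows "(\<Sum>c\<in>{1..m}. real_of_int (cartan (A1 m) b c) * (real c * (real m + 1 - real c))) = 2"
proof -
  define nb where "nb = {c\<in>{1..m}. c = b + 1 \<or> b = c + 1}"
  have nb: "nb = (if b = m then {} else {b + 1}) \<union> (if b = 1 then {} else {b - 1})"
    using assms by (auto simp: nb_def)
  have "(\<Sum>c\<in>{1..m}. real_of_int (cartan (A1 m) b c) * (real c * (real m + 1 - real c)))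
      = 2 * (real b * (real m + 1 - real b)) - (\<Sum>c\<in>nb. real c * (real m + 1 - real c))"
  proof (rule sum_neighbours)
    show "cartan (A1 m) b c = 2 * of_bool (b = c) - of_bool (c \<in> nb)" if "c \<in> {1..m}" for c
      using cartan_A_classical[OF assms that] that by (simp add: nb_def)
  qed (use assms in \<open>auto simp: nb_def\<close>)
  also have "\<dots> = 2"
    using assms by (auto simp: nb of_nat_diff algebra_simps)
  finally show ?thesis .
qed

text \<open>The coordinates of \<open>2\<rho>\<close> in type D. The generic formula at \<open>c = m - 1\<close> would give \<open>m (m - 1)\<close>, which
  is shared equally between the two spin nodes \<open>m - 1\<close> and \<open>m\<close>.\<close>

definition two_rho_D :: "nat \<Rightarrow> nat \<Rightarrow> real" where
  "two_rho_D m c = (if m - 1 \<le> c then real m * (real m - 1) / 2 else real c * (2 * real m - 1 - real c))"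

lemma two_rho_D:
  assumes "3 \<le> m" "b \<in> {1..m}"
  shows "(\<Sum>c\<in>{1..m}. real_of_int (cartan (D1 m) b c) * two_rho_D m c) = 2"
proof -
  define nb where "nb = {c\<in>{1..m}. D_edge m b c \<or> D_edge m c b}"
  have sum: "(\<Sum>c\<in>{1..m}. real_of_int (cartan (D1 m) b c) * two_rho_D m c)
      = 2 * two_rho_D m b - (\<Sum>c\<in>nb. two_rho_D m c)"
    by (rule sum_neighbours) (use assms in \<open>auto simp: nb_def\<close>)
  obtain k where k: "m = k + 3" using assms(1) le_Suc_ex by (metis add.commute)
  consider "b = k + 3 \<or> b = k + 2" | "b = m - 2" | "b < m - 2" using assms(2) k by force
  then show ?thesis
  proof cases
    case 1
    then have "nb = {k + 1}" by (elim disjE) (auto simp: nb_def D_edge_def k)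
    then show ?thesis using 1
      unfolding sum by (auto simp: two_rho_D_def k field_simps)
  next
    case 2
    then have "nb = {m - 1, m} \<union> (if k = 0 then {} else {m - 3})"
      using assms by (auto simp: nb_def D_edge_def k)
    then show ?thesis using 2 assms
      unfolding sum by (auto simp: two_rho_D_def k field_simps)
  next
    case 3
    then have "nb = {b + 1} \<union> (if b = 1 then {} else {b - 1})"
      using assms by (auto simp: nb_def D_edge_def)
    then show ?thesis using 3 assms
      unfolding sum by (auto simp: two_rho_D_def k of_nat_diff field_simps)
  qed
qed

lemma two_rho_E6:
  assumes "b \<in> {1..6}"
  shows "(\<Sum>c\<in>{1..6}. real_of_int (cartan E6_1 b c) *
      (if c = 3 then 42 else if c = 6 then 22 else if c \<in> {2, 4} then 30 else 16)) = 2"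
proof -
  have S: "{1..6} = {1, 2, 3, 4, 5, 6 :: nat}" by auto
  have "b \<in> {1, 2, 3, 4, 5, 6}" using assms S by blast
  then have "16 * cartan E6_1 b 1 + 30 * cartan E6_1 b 2 + 42 * cartan E6_1 b 3
      + 30 * cartan E6_1 b 4 + 16 * cartan E6_1 b 5 + 22 * cartan E6_1 b 6 = 2"
    by (elim insertE) (simp_all add: E6_edge_def)
  then have "real_of_int (16 * cartan E6_1 b 1 + 30 * cartan E6_1 b 2 + 42 * cartan E6_1 b 3
      + 30 * cartan E6_1 b 4 + 16 * cartan E6_1 b 5 + 22 * cartan E6_1 b 6) = 2"
    by (simp only: of_int_numeral)
  then show ?thesis unfolding S by (simp add: algebra_simps del: cartan.simps)
qed

text \<open>The vector \<open>r\<close> is \<open>2\<rho>\<close>, the sum of the positive roots. It serves both as the witness that the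
  Cartan matrix is an M-matrix and as the height functional bounding the depth of the tree.\<close>

lemma two_rho_exists:
  assumes "valid_X X"
  obtains r :: "nat \<Rightarrow> real" where "\<And>b. b \<in> cnodes_Y (Y_of X) \<Longrightarrow> 0 < r b"
    and "\<And>b. b \<in> cnodes_Y (Y_of X) \<Longrightarrow>
      (\<Sum>c\<in>cnodes_Y (Y_of X). real_of_int (cartan (Y_of X) b c) * r c) = 2"
proof (cases "Y_of X")
  case (A1 m)
  show ?thesis
    by (rule that[of "\<lambda>c. real c * (real m + 1 - real c)"])
      (use two_rho_A[of _ m] in \<open>auto simp: A1 cnodes_Y_eq simp del: cartan.simps\<close>)
next
  case (D1 m)
  then have "3 \<le> m" using assms by (cases X) auto
  then show ?thesis
    using that[of "two_rho_D m"] two_rho_D[of m]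
    by (auto simp: D1 cnodes_Y_eq two_rho_D_def simp del: cartan.simps)
next
  case E6_1
  show ?thesis
    by (rule that[of "\<lambda>c. if c = 3 then 42 else if c = 6 then 22 else if c \<in> {2, 4} then 30 else 16"])
      (use two_rho_E6 in \<open>auto simp: E6_1 cnodes_Y_eq simp del: cartan.simps\<close>)
qed

lemma sigma_maps:
  assumes "valid_X X" "b \<in> cnodes_Y (Y_of X)"
  shows "sigma X b \<in> cnodes_Y (Y_of X)"
  using assms by (cases X) (auto simp: cnodes_Y_eq)

lemma sigma_inj:
  assumes "valid_X X" 
  shows "inj_on (sigma X) (cnodes_Y (Y_of X))"
  using assms by (cases X) (auto simp: inj_on_def cnodes_Y_eq split: if_splits)

lemma sigma_cartan:
  assumes "valid_X X" "b \<in> cnodes_Y (Y_of X)" "c \<in> cnodes_Y (Y_of X)"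
  shows "cartan (Y_of X) (sigma X b) (sigma X c) = cartan (Y_of X) b c"
proof (cases "Y_of X")
  case (A1 m)
  have *: "b \<in> {1..m}" "c \<in> {1..m}" using assms by (auto simp: A1 cnodes_Y_eq)
  have "sigma X b = m + 1 - b" "sigma X c = m + 1 - c"
    using A1 assms * by (cases X; auto)+
  then have "sigma X b \<in> {1..m}" "sigma X c \<in> {1..m}"
    "sigma X b = sigma X c \<longleftrightarrow> b = c"
    "sigma X c = sigma X b + 1 \<or> sigma X b = sigma X c + 1 \<longleftrightarrow> c = b + 1 \<or> b = c + 1"
    using * by auto
  then show ?thesis
    unfolding A1 using * by (simp only: cartan_A_classical)
next
  case (D1 m)
  consider n where "X = B1 n \<or> X = A2_odd n" "m = n + 1" "2 \<le> n" | "X = G2_1 \<or> X = D4_3" "m = 4"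
    using D1 assms(1) by (cases X) simp_all
  then show ?thesis
  proof cases
    case (1 n)
    then obtain k where "n = k + 2" by (metis le_iff_add add.commute)
    then have k: "m = k + 3" "n = k + 2" using 1(2) by simp_all
    have edge: "D_edge m i j \<or> D_edge m j i \<longleftrightarrow> i + 1 = j \<and> j \<le> k + 2 \<or> j + 1 = i \<and> i \<le> k + 2
        \<or> i = k + 1 \<and> j = k + 3 \<or> j = k + 1 \<and> i = k + 3" if "1 \<le> i" "1 \<le> j" for i j
      using that by (auto simp: D_edge_def k)
    have s: "sigma X = (\<lambda>i. if i = k + 2 then k + 3 else if i = k + 3 then k + 2 else i)"
      using 1(1) by (auto simp: k fun_eq_iff)
    have bc: "1 \<le> b" "1 \<le> c" "b \<le> k + 3" "c \<le> k + 3"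
      using assms(2,3) by (auto simp: D1 cnodes_Y_eq k)
    have pos: "1 \<le> sigma X b" "1 \<le> sigma X c" using bc by (auto simp: s)
    have "sigma X b = sigma X c \<longleftrightarrow> b = c"
      by (simp add: s)
    moreover have "(D_edge m (sigma X b) (sigma X c) \<or> D_edge m (sigma X c) (sigma X b))
        \<longleftrightarrow> (D_edge m b c \<or> D_edge m c b)"
      unfolding edge[OF pos] edge[OF bc(1,2)] using bc by (auto simp: s)
    ultimately show ?thesis
      unfolding D1 by simp
  next
    case 2
    have edge: "D_edge m i j \<or> D_edge m j i \<longleftrightarrow> (i = 2) \<noteq> (j = 2)"
      if "i \<in> {1..4}" "j \<in> {1..4}" for i j
    proof -
      have "i \<in> {1, 2, 3, 4}" "j \<in> {1, 2, 3, 4}" using that by auto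
      then show ?thesis unfolding D_edge_def 2(2) by (elim insertE) simp_all
    qed
    have bc: "b \<in> {1..4}" "c \<in> {1..4}"
      using assms(2,3) by (auto simp: D1 2(2) cnodes_Y_eq)
    then have sbc: "sigma X b \<in> {1..4}" "sigma X c \<in> {1..4}"
      using sigma_maps[OF assms(1)] by (auto simp: D1 2(2) cnodes_Y_eq)
    have two: "sigma X i = 2 \<longleftrightarrow> i = 2" for i
      using 2(1) by (auto split: if_splits)
    have "sigma X b = sigma X c \<longleftrightarrow> b = c"
      using sigma_inj[OF assms(1)] assms(2,3) by (auto dest: inj_onD)
    then show ?thesis
      unfolding D1 cartan.simps edge[OF bc] edge[OF sbc] two by simp
  qed
next
  case E6_1
  have s: "sigma X i = (if 1 \<le> i \<and> i \<le> 5 then 6 - i else i)" for i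
    using E6_1 by (cases X) auto
  have edge: "E6_edge i j \<or> E6_edge j i \<longleftrightarrow>
      i \<le> 5 \<and> j \<le> 5 \<and> (j = i + 1 \<or> i = j + 1) \<or> i = 3 \<and> j = 6 \<or> i = 6 \<and> j = 3"
    if "i \<in> {1..6}" "j \<in> {1..6}" for i j
  proof -
    have chain: "{1..4::nat} = {1, 2, 3, 4}" by auto
    have E: "E6_edge i j \<longleftrightarrow> i \<in> {1..4} \<and> j = i + 1 \<or> i = 3 \<and> j = 6 \<or> i = 0 \<and> j = 6" for i j
      unfolding chain by (auto simp: E6_edge_def)
    show ?thesis
      using that unfolding E atLeastAtMost_iff by (cases "i = 6"; cases "j = 6") linarith+
  qed
  have bc: "b \<in> {1..6}" "c \<in> {1..6}"
    using assms(2,3) by (auto simp: E6_1 cnodes_Y_eq)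
  then have sbc: "sigma X b \<in> {1..6}" "sigma X c \<in> {1..6}"
    using sigma_maps[OF assms(1)] by (auto simp: E6_1 cnodes_Y_eq)
  have "sigma X b = sigma X c \<longleftrightarrow> b = c"
    using sigma_inj[OF assms(1)] assms(2,3) by (auto dest: inj_onD)
  moreover have "(E6_edge (sigma X b) (sigma X c) \<or> E6_edge (sigma X c) (sigma X b)) \<longleftrightarrow>
      (E6_edge b c \<or> E6_edge c b)"
  proof -
    have ends: "(sigma X x \<le> 5 \<longleftrightarrow> x \<le> 5) \<and> (sigma X x = 3 \<longleftrightarrow> x = 3) \<and> (sigma X x = 6 \<longleftrightarrow> x = 6)"
      if "x \<in> {1..6}" for x
    proof (cases "x = 6")
      case False
      then have "sigma X x + x = 6" "x \<le> 5" "1 \<le> x" using that by (simp_all add: s)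
      then show ?thesis by linarith
    qed (simp add: s)
    have flip: "sigma X y = sigma X x + 1 \<longleftrightarrow> x = y + 1" if "x \<in> {1..6}" "y \<in> {1..6}" "x \<le> 5" "y \<le> 5" for x y
    proof -
      have "sigma X x + x = 6" "sigma X y + y = 6" using that by (simp_all add: s)
      then show ?thesis by linarith
    qed
    show ?thesis
      unfolding edge[OF bc] edge[OF sbc]
      using ends[OF bc(1)] ends[OF bc(2)] flip[OF bc] flip[OF bc(2) bc(1)] by blast
  qed
  ultimately show ?thesis
    unfolding E6_1 by simp
qed

lemma iota_subset:
  assumes "valid_X X" "a \<in> cnodes_X X" "b \<in> iota X a"
  shows "b \<in> cnodes_Y (Y_of X)"
  using assms by (cases X) (auto simp: cnodes_Y_eq cnodes_X_eq split: if_splits)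

lemma iota_cover:
  assumes "valid_X X" "b \<in> cnodes_Y (Y_of X)"
  shows "\<exists>a\<in>cnodes_X X. b \<in> iota X a"
proof -
  have A: "\<exists>a\<in>{1..n}. b \<in> (if a < n then {a, 2 * n - a} else {n})" if "b \<in> {1..2 * n - 1}" for n
    by (rule bexI[of _ "if b \<le> n then b else 2 * n - b"]) (use that in auto)
  have D: "\<exists>a\<in>{1..n}. b \<in> (if a < n then {a} else {n, n + 1})" if "b \<in> {1..n + 1}" "1 \<le> n" for n
    by (rule bexI[of _ "if b \<le> n then b else n"]) (use that in auto)
  have E: "\<exists>a\<in>{1..4::nat}. b \<in> (if a = 1 then {6} else if a = 2 then {3} else if a = 3 then {2, 4} else {1, 5})"
    if "b \<in> {1..6}"
    by (rule bexI[of _ "if b = 6 then 1 else if b = 3 then 2 else if b \<in> {2,4} then 3 else 4"])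
      (use that in auto)
  have G: "\<exists>a\<in>{1..2::nat}. b \<in> (if a = 1 then {2} else {1, 3, 4})" if "b \<in> {1..4}"
    by (rule bexI[of _ "if b = 2 then 1 else 2"]) (use that in auto)
  show ?thesis
    using assms A D E G unfolding cnodes_Y_eq cnodes_X_eq
    by (cases X) (simp_all del: bex_simps)
qed

lemma iota_disjoint:
  assumes "valid_X X" "a \<in> cnodes_X X" "a' \<in> cnodes_X X" "b \<in> iota X a" "b \<in> iota X a'"
  shows "a = a'"
  using assms by (cases X) (auto simp: cnodes_X_eq split: if_splits)

lemma iota_sigma:
  assumes "valid_X X" "a \<in> cnodes_X X" "b \<in> iota X a"
  shows "sigma X b \<in> iota X a"
  using assms by (cases X) (auto simp: cnodes_X_eq split: if_splits)

lemma iota_index_eq: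
  assumes "valid_X X" "a \<in> cnodes_X X" "b \<in> iota X a"
  shows "iota_index X b = a"
  unfolding iota_index_def using assms iota_disjoint by (intro the_equality) blast+

text \<open>This dichotomy is why the selection condition, which mentions only the nodes with
  \<open>\<gamma>\<^sub>a = \<gamma>\<close>, controls divisibility by every \<open>\<gamma>\<^sub>a\<close>.\<close>

lemma gam_cases:
  assumes "a \<in> cnodes_X X"
  shows "gam X a = 1 \<or> gam X a = gam_max X"
proof -
  have fin: "finite (gam X ` cnodes_X X)" by (simp add: finite_cnodes_X)
  obtain g where g: "g \<ge> 1" "\<And>a. gam X a = 1 \<or> gam X a = g"
    by (cases X; force)
  show ?thesis
  proof (cases "gam X a = 1")
    case False
    then have "gam_max X = gam X a"
      unfolding gam_max_def using fin g assms
      by (intro Max_eqI) (auto, metis dual_order.refl)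
    then show ?thesis by simp
  qed simp
qed


section \<open>Fundamental weights and dominance\<close>

text \<open>Gaussian elimination of one index \<open>s\<close> replaces \<open>C\<close> by its Schur complement. All hypotheses survive
  with the same \<open>r\<close>: off-diagonal entries can only decrease, because the product \<open>C b s * C s c\<close> of two
  nonpositive entries is subtracted, and the row sums against \<open>r\<close> can only increase, because a
  nonpositive multiple of the positive row sum at \<open>s\<close> is subtracted.\<close>

lemma m_matrix_solvable:
  fixes C :: "'a \<Rightarrow> 'a \<Rightarrow> real" and r y :: "'a \<Rightarrow> real"
  assumes "finite S"
    and "\<And>b c. b \<in> S \<Longrightarrow> c \<in> S \<Longrightarrow> b \<noteq> c \<Longrightarrow> C b c \<le> 0"
    and "\<And>b. b \<in> S \<Longrightarrow> 0 < r b"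
    and "\<And>b. b \<in> S \<Longrightarrow> 0 < (\<Sum>c\<in>S. C b c * r c)"
  shows "\<exists>x. \<forall>b\<in>S. (\<Sum>c\<in>S. C b c * x c) = y b"
  using assms
proof (induction S arbitrary: C y rule: finite_induct)
  case empty
  then show ?case by simp
next
  case (insert s S)
  have nonpos: "C b c \<le> 0" if "b \<in> insert s S" "c \<in> insert s S" "b \<noteq> c" for b c
    using insert.prems(1) that by blast
  have row: "0 < C b s * r s + (\<Sum>c\<in>S. C b c * r c)" if "b \<in> insert s S" for b
    using insert.prems(3)[OF that] insert.hyps by simp
  have "(\<Sum>c\<in>S. C s c * r c) \<le> 0"
    using insert.hyps insert.prems(2) nonpos
    by (intro sum_nonpos mult_nonpos_nonneg) (auto intro: less_imp_le)
  then have "0 < C s s * r s" using row[of s] by simp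
  then have diag: "0 < C s s" using insert.prems(2)[of s] by (simp add: zero_less_mult_iff)
  define C' where "C' b c = C b c - C b s * C s c / C s s" for b c
  define y' where "y' b = y b - C b s * y s / C s s" for b
  have C'_sum: "(\<Sum>c\<in>S. C' b c * x c)
      = (\<Sum>c\<in>S. C b c * x c) - C b s / C s s * (\<Sum>c\<in>S. C s c * x c)" for b x
    by (simp add: C'_def left_diff_distrib sum_subtractf sum_distrib_left mult.assoc)
  have "\<exists>x. \<forall>b\<in>S. (\<Sum>c\<in>S. C' b c * x c) = y' b"
  proof (rule insert.IH)
    fix b c assume bc: "b \<in> S" "c \<in> S" "b \<noteq> c"
    then have "0 \<le> C b s * C s c"
      using nonpos[of b s] nonpos[of s c] insert.hyps(2) by (intro mult_nonpos_nonpos) auto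
    then show "C' b c \<le> 0"
      using order.trans[OF nonpos[of b c] divide_nonneg_pos[OF _ diag]] bc by (simp add: C'_def)
  next
    fix b assume b: "b \<in> S"
    have "C b s \<le> 0" using nonpos[of b s] b insert.hyps(2) by blast
    then have "0 \<le> - C b s / C s s" using diag by (simp add: divide_nonpos_pos)
    then have "0 \<le> - C b s / C s s * (C s s * r s + (\<Sum>c\<in>S. C s c * r c))"
      using row[of s] by (intro mult_nonneg_nonneg) auto
    also have "\<dots> = - C b s * r s - C b s / C s s * (\<Sum>c\<in>S. C s c * r c)"
      using diag by (simp add: field_simps)
    finally show "0 < (\<Sum>c\<in>S. C' b c * r c)"
      using row[of b] b unfolding C'_sum by simp
  qed (use insert.prems in auto)
  then obtain x where x: "\<And>b. b \<in> S \<Longrightarrow> (\<Sum>c\<in>S. C' b c * x c) = y' b" by blast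
  define x' where "x' = x(s := (y s - (\<Sum>c\<in>S. C s c * x c)) / C s s)"
  have x'_sum: "(\<Sum>c\<in>insert s S. C b c * x' c) = C b s * x' s + (\<Sum>c\<in>S. C b c * x c)" for b
    using insert.hyps by (auto simp: x'_def intro!: sum.cong)
  have "(\<Sum>c\<in>insert s S. C b c * x' c) = y b" if "b \<in> insert s S" for b
  proof (cases "b = s")
    case True
    then show ?thesis using diag unfolding x'_sum by (simp add: x'_def)
  next
    case False
    then have "(\<Sum>c\<in>S. C b c * x c) - C b s / C s s * (\<Sum>c\<in>S. C s c * x c)
        = y b - C b s * y s / C s s"
      using x[of b] that unfolding C'_sum y'_def by simp
    then show ?thesis using diag unfolding x'_sum by (simp add: x'_def field_simps)
  qed
  then show ?case by blast
qed

definition root_pairing :: "ytype \<Rightarrow> weight \<Rightarrow> nat \<Rightarrow> real" where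
  "root_pairing Y \<mu> b = (\<Sum>c\<in>cnodes_Y Y. real_of_int (cartan Y b c) * \<mu> c)"

lemma inv_form_eq: "inv_form Y \<mu> \<nu> = (\<Sum>b\<in>cnodes_Y Y. \<mu> b * root_pairing Y \<nu> b)"
  by (simp add: inv_form_def root_pairing_def sum_distrib_left mult.assoc)

lemma inv_form_commute: "inv_form Y \<mu> \<nu> = inv_form Y \<nu> \<mu>"
  unfolding inv_form_def by (subst sum.swap) (simp add: cartan_sym mult.commute mult.left_commute)

lemma inv_form_simple_root:
  assumes "b \<in> cnodes_Y Y"
  shows "inv_form Y (simple_root b) \<mu> = root_pairing Y \<mu> b"
    and "inv_form Y \<mu> (simple_root b) = root_pairing Y \<mu> b"
proof -
  have "inv_form Y (simple_root b) \<mu> = (\<Sum>c\<in>cnodes_Y Y. if c = b then root_pairing Y \<mu> c else 0)"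
    unfolding inv_form_eq simple_root_def by (intro sum.cong) auto
  then show "inv_form Y (simple_root b) \<mu> = root_pairing Y \<mu> b"
    using assms by (simp add: finite_cnodes_Y)
  then show "inv_form Y \<mu> (simple_root b) = root_pairing Y \<mu> b"
    by (simp add: inv_form_commute)
qed

lemma root_pairing_simple_root:
  "c \<in> cnodes_Y Y \<Longrightarrow> root_pairing Y (simple_root c) b = real_of_int (cartan Y b c)"
proof -
  assume c: "c \<in> cnodes_Y Y"
  have "root_pairing Y (simple_root c) b
      = (\<Sum>c'\<in>cnodes_Y Y. if c' = c then real_of_int (cartan Y b c') else 0)"
    unfolding root_pairing_def simple_root_def by (intro sum.cong) auto
  then show ?thesis using c by (simp add: finite_cnodes_Y)
qed

lemma root_pairing_diff: "root_pairing Y (\<lambda>c. \<mu> c - \<nu> c) b = root_pairing Y \<mu> b - root_pairing Y \<nu> b"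
  by (simp add: root_pairing_def algebra_simps sum_subtractf)

lemma root_pairing_sum:
  "root_pairing Y (\<lambda>c. \<Sum>j\<in>J. f j c) b = (\<Sum>j\<in>J. root_pairing Y (f j) b)"
  unfolding root_pairing_def sum_distrib_left by (rule sum.swap)

lemma root_pairing_zero [simp]: "root_pairing Y (\<lambda>_. 0) b = 0"
  by (simp add: root_pairing_def)

lemma lincomb_simple_root: "lincomb Y k simple_root = (\<lambda>c. if c \<in> cnodes_Y Y then k c else 0)"
proof
  fix c
  have "lincomb Y k simple_root c = (\<Sum>b\<in>cnodes_Y Y. if b = c then k b else 0)"
    unfolding lincomb_def simple_root_def by (intro sum.cong) auto
  then show "lincomb Y k simple_root c = (if c \<in> cnodes_Y Y then k c else 0)"
    by (simp add: finite_cnodes_Y)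
qed

lemma root_cone_iff:
  "\<mu> \<in> root_cone Y \<longleftrightarrow> \<mu> \<in> weight_space Y \<and> (\<forall>b\<in>cnodes_Y Y. \<mu> b \<in> \<nat>)"
proof
  assume R: "\<mu> \<in> weight_space Y \<and> (\<forall>b\<in>cnodes_Y Y. \<mu> b \<in> \<nat>)"
  then have "\<forall>b\<in>cnodes_Y Y. \<exists>k. \<mu> b = real k" by (auto elim: Nats_cases)
  then obtain k where "\<forall>b\<in>cnodes_Y Y. \<mu> b = real (k b)" by metis
  then have "\<mu> = lincomb Y (\<lambda>b. real (k b)) simple_root"
    using R by (auto simp: lincomb_simple_root weight_space_def)
  then show "\<mu> \<in> root_cone Y" unfolding root_cone_def by blast
qed (auto simp: root_cone_def lincomb_simple_root weight_space_def)

lemma same_orbit_invariant_iff: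
  assumes "valid_X X"
  shows "(\<forall>b\<in>cnodes_Y (Y_of X). \<forall>b'\<in>cnodes_Y (Y_of X). same_orbit X b b' \<longrightarrow> f b = f b')
    \<longleftrightarrow> (\<forall>b\<in>cnodes_Y (Y_of X). f (sigma X b) = f b)" (is "?L \<longleftrightarrow> ?R")
proof
  assume L: ?L
  show ?R
  proof
    fix b assume b: "b \<in> cnodes_Y (Y_of X)"
    have "same_orbit X b (sigma X b)" unfolding same_orbit_def by (rule exI[of _ 1]) simp
    then show "f (sigma X b) = f b" using L b sigma_maps[OF assms b] by metis
  qed
next
  assume R: ?R
  have "(sigma X ^^ k) b \<in> cnodes_Y (Y_of X) \<and> f ((sigma X ^^ k) b) = f b"
    if "b \<in> cnodes_Y (Y_of X)" for b k
    by (induction k) (use that R sigma_maps[OF assms] in auto)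
  then show ?L unfolding same_orbit_def by metis
qed

lemma sum_sigma:
  assumes "valid_X X"
  shows "(\<Sum>b\<in>cnodes_Y (Y_of X). f (sigma X b)) = (\<Sum>b\<in>cnodes_Y (Y_of X). f b)"
proof -
  have "sigma X ` cnodes_Y (Y_of X) = cnodes_Y (Y_of X)"
    by (rule endo_inj_surj) (use sigma_maps sigma_inj assms finite_cnodes_Y in auto)
  then show ?thesis
    using sum.reindex[OF sigma_inj[OF assms], of f] by (simp add: o_def)
qed

text \<open>Reindexing the sum along the bijection \<open>\<sigma>\<close> of the nodes moves \<open>\<sigma>\<close> from the root to the weight.\<close>

lemma root_pairing_sigma:
  assumes "valid_X X" "b \<in> cnodes_Y (Y_of X)"
  shows "root_pairing (Y_of X) \<mu> (sigma X b) = root_pairing (Y_of X) (\<lambda>c. \<mu> (sigma X c)) b"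
  unfolding root_pairing_def sum_sigma[OF assms(1), symmetric,
      of "\<lambda>c. real_of_int (cartan (Y_of X) (sigma X b) c) * \<mu> c"]
  by (rule sum.cong) (simp_all add: sigma_cartan[OF assms(1)] assms(2))

lemma cartan_solvable:
  assumes "valid_X X"
  obtains \<mu> where "\<mu> \<in> weight_space (Y_of X)"
    and "\<And>b. b \<in> cnodes_Y (Y_of X) \<Longrightarrow> root_pairing (Y_of X) \<mu> b = y b"
proof -
  let ?Y = "Y_of X" and ?N = "cnodes_Y (Y_of X)"
  obtain r where r: "\<And>b. b \<in> ?N \<Longrightarrow> 0 < r b"
    "\<And>b. b \<in> ?N \<Longrightarrow> (\<Sum>c\<in>?N. real_of_int (cartan ?Y b c) * r c) = 2"
    using two_rho_exists[OF assms] by blast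
  have "\<exists>x. \<forall>b\<in>?N. (\<Sum>c\<in>?N. real_of_int (cartan ?Y b c) * x c) = y b"
    by (rule m_matrix_solvable[where r = r]) (simp_all add: finite_cnodes_Y r cartan_offdiag)
  then obtain x where x: "\<And>b. b \<in> ?N \<Longrightarrow> root_pairing ?Y x b = y b"
    unfolding root_pairing_def by blast
  show ?thesis
  proof (rule that[of "\<lambda>c. if c \<in> ?N then x c else 0"])
    show "root_pairing ?Y (\<lambda>c. if c \<in> ?N then x c else 0) b = y b" if "b \<in> ?N" for b
      unfolding x[OF that, symmetric] root_pairing_def by (rule sum.cong) simp_all
  qed (simp add: weight_space_def)
qed

text \<open>For a symmetric matrix, solvability already gives injectivity: pairing \<open>\<mu>\<close> with a solution \<open>x\<close> of
  \<open>(x | \<alpha>\<^sub>c) = \<delta>\<^sub>c\<^sub>b\<close> reads off the coordinate \<open>\<mu> b\<close>.\<close>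

lemma weight_ext:
  assumes "valid_X X" "\<mu> \<in> weight_space (Y_of X)" "\<nu> \<in> weight_space (Y_of X)"
    and "\<And>b. b \<in> cnodes_Y (Y_of X) \<Longrightarrow> root_pairing (Y_of X) \<mu> b = root_pairing (Y_of X) \<nu> b"
  shows "\<mu> = \<nu>"
proof
  fix b
  let ?Y = "Y_of X" and ?N = "cnodes_Y (Y_of X)"
  show "\<mu> b = \<nu> b"
  proof (cases "b \<in> ?N")
    case True
    obtain x where x: "\<And>c. c \<in> ?N \<Longrightarrow> root_pairing ?Y x c = of_bool (c = b)"
      by (rule cartan_solvable[OF assms(1), of "\<lambda>c. of_bool (c = b)"]) blast
    have eval: "inv_form ?Y \<rho> x = \<rho> b" for \<rho>
    proof -
      have "inv_form ?Y \<rho> x = (\<Sum>c\<in>?N. if c = b then \<rho> c else 0)"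
        unfolding inv_form_eq by (intro sum.cong) (auto simp: x)
      then show ?thesis using True by (simp add: finite_cnodes_Y)
    qed
    have "inv_form ?Y x \<mu> = inv_form ?Y x \<nu>"
      unfolding inv_form_eq by (intro sum.cong) (simp_all add: assms(4))
    then show ?thesis by (simp add: eval inv_form_commute[of _ x])
  next
    case False
    then show ?thesis using assms(2,3) by (simp add: weight_space_def)
  qed
qed

lemma fund_spec:
  assumes "valid_X X"
  shows "fund (Y_of X) c \<in> weight_space (Y_of X)"
    and "b \<in> cnodes_Y (Y_of X) \<Longrightarrow> root_pairing (Y_of X) (fund (Y_of X) c) b = of_bool (b = c)"
proof -
  let ?Y = "Y_of X" and ?N = "cnodes_Y (Y_of X)"
  obtain \<mu> where \<mu>: "\<mu> \<in> weight_space ?Y" "\<And>b. b \<in> ?N \<Longrightarrow> root_pairing ?Y \<mu> b = of_bool (b = c)"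
    by (rule cartan_solvable[OF assms, of "\<lambda>b. of_bool (b = c)"]) blast
  have "fund ?Y c = \<mu>"
    unfolding fund_def by (rule the_equality)
      (use \<mu> weight_ext[OF assms] in \<open>auto simp: inv_form_simple_root\<close>)
  then show "fund ?Y c \<in> weight_space ?Y"
    "b \<in> ?N \<Longrightarrow> root_pairing ?Y (fund ?Y c) b = of_bool (b = c)" using \<mu> by simp_all
qed

lemma inv_form_fund:
  assumes "valid_X X" "b \<in> cnodes_Y (Y_of X)"
  shows "inv_form (Y_of X) \<mu> (fund (Y_of X) b) = \<mu> b"
proof -
  have "inv_form (Y_of X) \<mu> (fund (Y_of X) b)
      = (\<Sum>c\<in>cnodes_Y (Y_of X). if c = b then \<mu> c else 0)"
    unfolding inv_form_eq by (intro sum.cong) (auto simp: fund_spec[OF assms(1)])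
  then show ?thesis using assms(2) by (simp add: finite_cnodes_Y)
qed

lemma lincomb_fund:
  assumes "valid_X X"
  shows "lincomb (Y_of X) k (fund (Y_of X)) \<in> weight_space (Y_of X)"
    and "b \<in> cnodes_Y (Y_of X) \<Longrightarrow> root_pairing (Y_of X) (lincomb (Y_of X) k (fund (Y_of X))) b = k b"
proof -
  let ?Y = "Y_of X" and ?N = "cnodes_Y (Y_of X)"
  show "lincomb ?Y k (fund ?Y) \<in> weight_space ?Y"
    using fund_spec(1)[OF assms] by (auto simp: lincomb_def weight_space_def)
  assume b: "b \<in> ?N"
  have "root_pairing ?Y (lincomb ?Y k (fund ?Y)) b = (\<Sum>c\<in>?N. k c * root_pairing ?Y (fund ?Y c) b)"
    unfolding lincomb_def root_pairing_sum
    by (simp add: root_pairing_def sum_distrib_left mult.left_commute)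
  also have "\<dots> = (\<Sum>c\<in>?N. if b = c then k c else 0)"
    by (intro sum.cong) (auto simp: fund_spec(2)[OF assms b])
  finally show "root_pairing ?Y (lincomb ?Y k (fund ?Y)) b = k b"
    using b by (simp add: finite_cnodes_Y)
qed

lemma dominant_iff:
  assumes "valid_X X"
  shows "\<mu> \<in> dominant (Y_of X) \<longleftrightarrow> \<mu> \<in> weight_space (Y_of X) \<and>
    (\<forall>b\<in>cnodes_Y (Y_of X). root_pairing (Y_of X) \<mu> b \<in> \<nat>)"
proof
  assume R: "\<mu> \<in> weight_space (Y_of X) \<and> (\<forall>b\<in>cnodes_Y (Y_of X). root_pairing (Y_of X) \<mu> b \<in> \<nat>)"
  then have "\<forall>b\<in>cnodes_Y (Y_of X). \<exists>k. root_pairing (Y_of X) \<mu> b = real k" by (auto elim: Nats_cases)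
  then obtain k where "\<forall>b\<in>cnodes_Y (Y_of X). root_pairing (Y_of X) \<mu> b = real (k b)" by metis
  then have "\<mu> = lincomb (Y_of X) (\<lambda>b. real (k b)) (fund (Y_of X))"
    using R by (intro weight_ext[OF assms]) (auto simp: lincomb_fund[OF assms])
  then show "\<mu> \<in> dominant (Y_of X)" unfolding dominant_def by blast
qed (auto simp: dominant_def lincomb_fund[OF assms])

text \<open>By symmetry of the form, \<open>(2\<rho> | \<mu>)\<close> is twice the height of \<open>\<mu>\<close> and also a positive combination of
  the numbers \<open>(\<alpha>\<^sub>b | \<mu>)\<close>.\<close>

lemma height_nonneg:
  assumes "valid_X X" "\<And>b. b \<in> cnodes_Y (Y_of X) \<Longrightarrow> 0 \<le> root_pairing (Y_of X) \<mu> b"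
  shows "0 \<le> (\<Sum>b\<in>cnodes_Y (Y_of X). \<mu> b)"
proof -
  let ?Y = "Y_of X" and ?N = "cnodes_Y (Y_of X)"
  obtain r where r: "\<And>b. b \<in> ?N \<Longrightarrow> 0 < r b" "\<And>b. b \<in> ?N \<Longrightarrow> root_pairing ?Y r b = 2"
    using two_rho_exists[OF assms(1)] unfolding root_pairing_def by blast
  have "0 \<le> inv_form ?Y r \<mu>"
    unfolding inv_form_eq by (intro sum_nonneg mult_nonneg_nonneg) (simp_all add: assms(2) r less_imp_le)
  also have "\<dots> = 2 * (\<Sum>b\<in>?N. \<mu> b)"
    unfolding inv_form_commute[of _ r] by (simp add: inv_form_eq r sum_distrib_left mult.commute)
  finally show ?thesis by simp
qed


section \<open>Tail sums\<close>

text \<open>Applied to the row multiplicities of a partition, \<open>tail f j\<close> is the length of its \<open>j\<close>-th column.\<close>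

definition tail :: "(nat \<Rightarrow> real) \<Rightarrow> nat \<Rightarrow> real" where
  "tail f j = Sum_any (\<lambda>i. if j \<le> i then f i else 0)"

lemma tail_eq:
  assumes "\<And>k. K \<le> k \<Longrightarrow> f k = 0"
  shows "tail f j = (\<Sum>k\<in>{j..<K}. f k)"
proof -
  have "tail f j = (\<Sum>k\<in>{j..<K}. if j \<le> k then f k else 0)"
    unfolding tail_def by (rule Sum_any.expand_superset) (auto split: if_splits, metis assms not_le)
  then show ?thesis by simp
qed

lemma tail_Suc:
  assumes "\<And>k. K \<le> k \<Longrightarrow> f k = 0"
  shows "tail f j = f j + tail f (Suc j)"
proof (cases "j < K")
  case True
  then show ?thesis by (simp add: tail_eq[of K, OF assms] sum.atLeast_Suc_lessThan)
qed (simp add: tail_eq[of K, OF assms] assms)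

text \<open>Both sides count the boxes in the first \<open>i\<close> columns, by rows and by columns.\<close>

lemma Sum_any_min_eq_tail:
  assumes "\<And>k. K \<le> k \<Longrightarrow> f k = 0"
  shows "Sum_any (\<lambda>k. real (min i k) * f k) = (\<Sum>j=1..i. tail f j)"
proof -
  have "Sum_any (\<lambda>k. real (min i k) * f k) = (\<Sum>k<K. real (min i k) * f k)"
    by (rule Sum_any.expand_superset) (use assms not_le in auto)
  also have "\<dots> = (\<Sum>k<K. \<Sum>j=1..i. if j \<le> k then f k else 0)"
  proof (rule sum.cong[OF refl])
    fix k
    have "(\<Sum>j=1..i. if j \<le> k then f k else 0) = (\<Sum>j\<in>{1..i} \<inter> {..k}. f k)"
      by (subst sum.inter_restrict) simp_all
    also have "{1..i} \<inter> {..k} = {1..min i k}" by auto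
    finally show "real (min i k) * f k = (\<Sum>j=1..i. if j \<le> k then f k else 0)" by simp
  qed
  also have "\<dots> = (\<Sum>j=1..i. \<Sum>k<K. if j \<le> k then f k else 0)"
    by (rule sum.swap)
  also have "\<dots> = (\<Sum>j=1..i. tail f j)"
  proof (rule sum.cong[OF refl])
    fix j
    have "(\<Sum>k<K. if j \<le> k then f k else 0) = (\<Sum>k\<in>{..<K} \<inter> {j..}. f k)"
      by (subst sum.inter_restrict) simp_all
    also have "{..<K} \<inter> {j..} = {j..<K}" by auto
    finally show "(\<Sum>k<K. if j \<le> k then f k else 0) = tail f j"
      by (simp add: tail_eq[of K, OF assms])
  qed
  finally show ?thesis .
qed

lemma Sum_any_index_eq_tail:
  assumes "\<And>k. K \<le> k \<Longrightarrow> f k = 0" "K \<le> J"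
  shows "Sum_any (\<lambda>k. real k * f k) = (\<Sum>j=1..J. tail f j)"
proof -
  have "(\<lambda>k. real k * f k) = (\<lambda>k. real (min J k) * f k)"
  proof
    fix k
    show "real k * f k = real (min J k) * f k"
      by (cases "K \<le> k") (use assms in auto)
  qed
  then show ?thesis by (simp only: Sum_any_min_eq_tail[OF assms(1)])
qed

section \<open>Closed form and termination of the algorithm\<close>

locale virtual_kleber =
  fixes X :: xtype and L :: "nat \<Rightarrow> nat \<Rightarrow> nat"
  assumes valid: "valid_X X"
    and finite_L: "finite {(a, i). a \<in> cnodes_X X \<and> 1 \<le> i \<and> L a i \<noteq> 0}"
begin

abbreviation "Y \<equiv> Y_of X"
abbreviation "N \<equiv> cnodes_Y (Y_of X)"
abbreviation "Lh b k \<equiv> real (Lhat X L b k)"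
abbreviation "A \<equiv> added_weight X L"

lemma iota_index_spec:
  assumes "b \<in> N"
  shows "iota_index X b \<in> cnodes_X X" "b \<in> iota X (iota_index X b)"
  using iota_cover[OF valid assms] iota_index_eq[OF valid] by auto

lemma Lhat_sigma:
  assumes "b \<in> N"
  shows "Lhat X L (sigma X b) k = Lhat X L b k"
proof -
  have "iota_index X (sigma X b) = iota_index X b"
    using iota_index_eq[OF valid] iota_sigma[OF valid] iota_index_spec[OF assms] by blast
  then show ?thesis by (simp add: Lhat_def)
qed

lemma Lhat_eventually_zero:
  obtains K where "\<And>b k. b \<in> N \<Longrightarrow> K \<le> k \<Longrightarrow> Lhat X L b k = 0"
proof -
  have "finite (snd ` {(a, i). a \<in> cnodes_X X \<and> 1 \<le> i \<and> L a i \<noteq> 0})"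
    using finite_L by (rule finite_imageI)
  then obtain M where "\<forall>i\<in>snd ` {(a, i). a \<in> cnodes_X X \<and> 1 \<le> i \<and> L a i \<noteq> 0}. i < M"
    using finite_nat_set_iff_bounded by blast
  then have M: "i < M" if "a \<in> cnodes_X X" "1 \<le> i" "L a i \<noteq> 0" for a i
    using that by force
  have gam: "1 \<le> gam X a \<and> gam X a \<le> 3" for a
    by (cases X) auto
  show ?thesis
  proof (rule that[of "3 * M + 1"])
    fix b k assume b: "b \<in> N" and k: "3 * M + 1 \<le> k"
    let ?a = "iota_index X b"
    note a = iota_index_spec(1)[OF b]
    have "L ?a k = 0" using M[OF a, of k] k by linarith
    moreover have "L ?a (k div gam X ?a) = 0" if dvd: "gam X ?a dvd k"
    proof (rule ccontr)
      assume nz: "L ?a (k div gam X ?a) \<noteq> 0"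
      obtain q where q: "k = gam X ?a * q" using dvd by blast
      then have "k div gam X ?a = q" using gam[of ?a] by simp
      moreover have "1 \<le> q" using k q by (cases q) auto
      ultimately have "q < M" using M[OF a] nz by metis
      then have "gam X ?a * q \<le> 3 * M" using gam[of ?a] by (intro mult_mono) auto
      then show False using k q by simp
    qed
    ultimately show "Lhat X L b k = 0" by (auto simp: Lhat_def Let_def)
  qed
qed

lemma added_weight_tail: "A j = lincomb Y (\<lambda>b. tail (Lh b) j) (fund Y)"
  by (simp add: added_weight_def tail_def)

lemma added_weight_in_space: "A j \<in> weight_space Y"
  unfolding added_weight_tail by (rule lincomb_fund(1)[OF valid])

lemma pairing_added_weight: "b \<in> N \<Longrightarrow> root_pairing Y (A j) b = tail (Lh b) j"
  unfolding added_weight_tail by (rule lincomb_fund(2)[OF valid])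

lemma tail_Lhat_nat:
  assumes "b \<in> N"
  shows "tail (Lh b) j \<in> \<nat>"
proof -
  obtain K where "\<And>b k. b \<in> N \<Longrightarrow> K \<le> k \<Longrightarrow> Lhat X L b k = 0" by (rule Lhat_eventually_zero) blast
  then have "tail (Lh b) j = real (\<Sum>k\<in>{j..<K}. Lhat X L b k)"
    using assms by (simp add: tail_eq[of K])
  then show ?thesis by (simp only: of_nat_in_Nats)
qed

lemma added_weight_eq_0:
  assumes "\<And>b k. b \<in> N \<Longrightarrow> K \<le> k \<Longrightarrow> Lhat X L b k = 0" "K \<le> j"
  shows "A j = (\<lambda>_. 0)"
proof (rule weight_ext[OF valid added_weight_in_space])
  fix b assume "b \<in> N"
  then show "root_pairing Y (A j) b = root_pairing Y (\<lambda>_. 0) b"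
    using assms by (simp add: pairing_added_weight tail_eq[of K])
qed (simp add: weight_space_def)

text \<open>A round adding the zero weight forces all multiplicities of index at least \<open>j\<close> to vanish, since they
  are nonnegative.
  Hence a round that changes nothing cannot be followed by one that shifts the weights.\<close>

lemma added_weight_zero_mono:
  assumes "A j = (\<lambda>_. 0)" "j \<le> i"
  shows "A i = (\<lambda>_. 0)"
proof (rule added_weight_eq_0[of i])
  fix b k assume b: "b \<in> N" and "i \<le> k"
  then have jk: "j \<le> k" using assms(2) by simp
  obtain K where K: "\<And>b k. b \<in> N \<Longrightarrow> K \<le> k \<Longrightarrow> Lhat X L b k = 0" by (rule Lhat_eventually_zero) blast
  have "(\<Sum>k\<in>{j..<K}. Lh b k) = 0"
    using pairing_added_weight[OF b, of j] b K by (simp add: assms(1) tail_eq[of K])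
  then have "\<forall>k\<in>{j..<K}. Lhat X L b k = 0"
    by (subst (asm) sum_nonneg_eq_0_iff) auto
  then show "Lhat X L b k = 0" using K[OF b, of k] jk by (cases "k < K") auto
qed simp

text \<open>The weight which a node had when it was attached is the last entry of its name; the root started
  with weight \<open>0\<close>.\<close>

definition attached :: "weight list \<Rightarrow> weight" where
  "attached y = (if y = [] then (\<lambda>_. 0) else last y)"

text \<open>The edge label \<open>d\<^sub>j\<close> above depth \<open>j\<close> on the branch to \<open>y\<close>. The parent was attached one round earlier, so
  at the time of comparison its weight has grown by \<open>A j\<close>. Labels below the end of the branch are
  zero, which lets statements about consecutive labels include the last one.\<close>

definition edge :: "weight list \<Rightarrow> nat \<Rightarrow> weight" where
  "edge y j = (if 1 \<le> j \<and> j \<le> length y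
     then wminus (\<lambda>c. attached (take (j - 1) y) c + A j c) (attached (take j y)) else (\<lambda>_. 0))"

text \<open>Rules (i)-(iii) for the step of the branch that leads to depth \<open>j\<close>, stated without reference to the
  current tree.\<close>

definition admissible :: "weight list \<Rightarrow> nat \<Rightarrow> bool" where
  "admissible y j \<longleftrightarrow>
     attached (take j y) \<in> dominant Y \<and> edge y j \<noteq> (\<lambda>_. 0) \<and> edge y j \<in> root_cone Y \<and>
     (1 < j \<longrightarrow> wminus (edge y (j - 1)) (edge y j) \<in> root_cone Y) \<and>
     (\<forall>b\<in>N. root_pairing Y (attached (take j y)) (sigma X b) = root_pairing Y (attached (take j y)) b) \<and>
     (\<forall>a\<in>cnodes_X X. \<not> gam X a dvd (j - 1) \<longrightarrow> (\<forall>b\<in>iota X a. edge y (j - 1) b = edge y j b))"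

definition branch :: "weight list \<Rightarrow> bool" where
  "branch y \<longleftrightarrow> (\<forall>j\<in>{1..length y}. admissible y j)"

lemma edge_append: "j \<le> length y \<Longrightarrow> edge (y @ z) j = edge y j"
  by (simp add: edge_def)

lemma admissible_append: "j \<le> length y \<Longrightarrow> admissible (y @ z) j \<longleftrightarrow> admissible y j"
  by (simp add: admissible_def edge_append)

lemma branch_snoc:
  "branch (y @ [\<tau>]) \<longleftrightarrow> branch y \<and> admissible (y @ [\<tau>]) (Suc (length y))"
  by (auto simp: branch_def admissible_append atLeastAtMostSuc_conv)

lemma branch_Nil [simp]: "branch []"
  by (simp add: branch_def)

text \<open>Later rounds shift a node and its parent by the same weight, so the label of the edge above \<open>x\<close> in
  the current tree is the one fixed when \<open>x\<close> was attached. For \<open>x = []\<close>, rule (iii) is void in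
  both descriptions because every \<open>\<gamma>\<^sub>a\<close> divides \<open>0\<close>.\<close>

lemma may_attach_iff:
  assumes T: "\<And>x. T x = (if length x \<le> l \<and> branch x
      then Some (\<lambda>c. attached x c + (\<Sum>j\<in>{length x<..Suc l}. A j c)) else None)"
  shows "may_attach X (Suc l) T x \<tau> \<longleftrightarrow> length x = l \<and> branch (x @ [\<tau>])"
proof (cases "length x = l \<and> branch x")
  case True
  then have l: "length x = l" and x: "branch x" by auto
  have wt: "wt T x = (\<lambda>c. attached x c + A (Suc l) c)"
    using True by (simp add: wt_def T flip: atLeastSucAtMost_greaterThanAtMost)
  have new: "wminus (wt T x) \<tau> = edge (x @ [\<tau>]) (Suc l)"
    using l by (simp add: wt edge_def attached_def)
  have old: "edge_diff T (butlast x) x = edge (x @ [\<tau>]) l" if nonempty: "x \<noteq> []"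
  proof -
    obtain k where k: "l = Suc k" using nonempty l by (cases l) auto
    have "x = butlast x @ [last x]" using nonempty by simp
    then have "branch (butlast x)" using x branch_snoc by metis
    moreover have "length (butlast x) = k" using l k by simp
    moreover have "{k<..Suc l} = {Suc k, Suc (Suc k)}" using k by auto
    ultimately have "wt T (butlast x) = (\<lambda>c. attached (butlast x) c + A l c + A (Suc l) c)"
      using k by (simp add: wt_def T add.assoc)
    moreover have "take k x = butlast x" using l k by (simp add: butlast_conv_take)
    ultimately show ?thesis
      unfolding edge_diff_def using l k wt by (simp add: edge_append wminus_def edge_def)
  qed
  have "\<tau> \<noteq> wt T x \<longleftrightarrow> edge (x @ [\<tau>]) (Suc l) \<noteq> (\<lambda>_. 0)"
    by (simp flip: new add: wminus_def fun_eq_iff) metis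
  moreover have "dominates Y (wt T x) \<tau> \<longleftrightarrow> edge (x @ [\<tau>]) (Suc l) \<in> root_cone Y"
    by (simp add: dominates_def new)
  moreover have "(x \<noteq> [] \<longrightarrow> dominates Y (edge_diff T (butlast x) x) (wminus (wt T x) \<tau>)) \<longleftrightarrow>
      (1 < Suc l \<longrightarrow> wminus (edge (x @ [\<tau>]) l) (edge (x @ [\<tau>]) (Suc l)) \<in> root_cone Y)"
    using l by (auto simp: dominates_def new old)
  moreover have "(\<forall>b\<in>N. \<forall>b'\<in>N. same_orbit X b b' \<longrightarrow>
        inv_form Y \<tau> (simple_root b) = inv_form Y \<tau> (simple_root b')) \<longleftrightarrow>
      (\<forall>b\<in>N. root_pairing Y \<tau> (sigma X b) = root_pairing Y \<tau> b)"
    using same_orbit_invariant_iff[OF valid, of "root_pairing Y \<tau>"] by (simp add: inv_form_simple_root)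
  moreover have "(\<forall>a\<in>cnodes_X X. \<not> gam X a dvd l \<longrightarrow> (\<forall>b\<in>iota X a.
        inv_form Y (edge_diff T (butlast x) x) (fund Y b) = inv_form Y (wminus (wt T x) \<tau>) (fund Y b))) \<longleftrightarrow>
      (\<forall>a\<in>cnodes_X X. \<not> gam X a dvd l \<longrightarrow>
        (\<forall>b\<in>iota X a. edge (x @ [\<tau>]) l b = edge (x @ [\<tau>]) (Suc l) b))"
    (is "?P \<longleftrightarrow> ?Q")
  proof (cases "x = []")
    case True
    then show ?thesis using l by auto
  next
    case False
    then show ?thesis
      unfolding new old[OF False] by (auto simp: inv_form_fund[OF valid] iota_subset[OF valid])
  qed
  moreover have "x \<in> dom T" using True by (simp add: dom_def T)
  moreover have "attached (x @ [\<tau>]) = \<tau>" by (simp add: attached_def)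
  ultimately show ?thesis
    using l x by (simp add: may_attach_def Let_def branch_snoc admissible_def)
next
  case False
  then have "\<not> (x \<in> dom T \<and> length x = l)" by (auto simp: dom_def T split: if_splits)
  then show ?thesis using False by (auto simp: may_attach_def Let_def branch_snoc)
qed

lemma kleber_tree_eq:
  "kleber_tree X L l y = (if length y \<le> l \<and> branch y
     then Some (\<lambda>c. attached y c + (\<Sum>j\<in>{length y<..l}. A j c)) else None)"
proof (induction l arbitrary: y)
  case 0
  then show ?case by (auto simp: initial_tree_def attached_def)
next
  case (Suc l)
  define T where "T = shift_tree X L (Suc l) (kleber_tree X L l)"
  have T: "T x = (if length x \<le> l \<and> branch x
      then Some (\<lambda>c. attached x c + (\<Sum>j\<in>{length x<..Suc l}. A j c)) else None)" for x
  proof -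
    have "{length x<..Suc l} = insert (Suc l) {length x<..l}" if "length x \<le> l"
      using that by auto
    then show ?thesis by (auto simp: T_def shift_tree_def Suc algebra_simps)
  qed
  have "y \<noteq> [] \<and> may_attach X (Suc l) T (butlast y) (last y) \<longleftrightarrow> length y = Suc l \<and> branch y"
    by (cases y rule: rev_cases) (auto simp: may_attach_iff[OF T])
  moreover have "last y = attached y" if "length y = Suc l"
    using that by (auto simp: attached_def)
  ultimately show ?case
    by (auto simp: attach_children_def T_def[symmetric] T)
qed

text \<open>Telescoping the definition of the edge labels.\<close>

lemma attached_take:
  assumes "j \<le> length y"
  shows "attached (take j y) c = (\<Sum>i=1..j. A i c - edge y i c)"
  using assms
proof (induction j)
  case 0
  then show ?case by (simp add: attached_def)
next
  case (Suc j)
  then show ?case by (simp add: edge_def wminus_def)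
qed

lemma branch_edge_decreasing:
  assumes "branch y" "1 \<le> j"
  shows "wminus (edge y j) (edge y (Suc j)) \<in> root_cone Y"
proof -
  have zero: "(\<lambda>_. 0) \<in> root_cone Y" by (simp add: root_cone_iff weight_space_def)
  have out: "edge y i = (\<lambda>_. 0)" if "length y < i" for i using that by (simp add: edge_def)
  have in_cone: "edge y j \<in> root_cone Y"
    using assms zero out by (cases "j \<le> length y") (auto simp: branch_def admissible_def)
  show "wminus (edge y j) (edge y (Suc j)) \<in> root_cone Y"
  proof (cases "Suc j \<le> length y")
    case True
    then have "admissible y (Suc j)" using assms by (auto simp: branch_def)
    then show ?thesis using assms by (simp add: admissible_def)
  next
    case False
    then show ?thesis using in_cone out[of "Suc j"] by (simp add: wminus_def)
  qed
qed

text \<open>The weight with which the last node is attached has nonnegative height. This height is the total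
  height added so far minus the heights of the edge labels, each of which is at least one.\<close>

lemma branch_length_le:
  assumes "\<And>b k. b \<in> N \<Longrightarrow> K \<le> k \<Longrightarrow> Lhat X L b k = 0" "branch y"
  shows "real (length y) \<le> (\<Sum>j=1..K. \<Sum>b\<in>N. A j b)"
proof -
  let ?ht = "\<lambda>\<mu> :: weight. \<Sum>b\<in>N. \<mu> b"
  have ht_A: "0 \<le> ?ht (A j)" for j
    by (rule height_nonneg[OF valid]) (metis Nats_cases of_nat_0_le_iff pairing_added_weight tail_Lhat_nat)
  have ht_edge: "1 \<le> ?ht (edge y j)" if "j \<in> {1..length y}" for j
  proof -
    have adm: "admissible y j" using assms(2) that by (simp add: branch_def)
    then have nat: "\<forall>b\<in>N. edge y j b \<in> \<nat>" and space: "edge y j \<in> weight_space Y"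
      and "edge y j \<noteq> (\<lambda>_. 0)" by (auto simp: admissible_def root_cone_iff)
    then obtain b where "edge y j b \<noteq> 0" by auto
    then have b: "b \<in> N" "edge y j b \<noteq> 0" using space by (auto simp: weight_space_def)
    then have "1 \<le> edge y j b" using nat by (auto elim!: Nats_cases)
    also have "\<dots> \<le> ?ht (edge y j)"
      using b nat by (intro member_le_sum) (auto simp: finite_cnodes_Y elim!: Nats_cases)
    finally show ?thesis .
  qed
  have "0 \<le> ?ht (attached y)"
  proof (cases "y = []")
    case True
    then show ?thesis by (simp add: attached_def)
  next
    case False
    then have "admissible y (length y)" using assms(2) by (auto simp: branch_def Suc_le_eq)
    then have "attached y \<in> dominant Y" by (simp add: admissible_def)
    then show ?thesis
      by (intro height_nonneg[OF valid]) (metis Nats_cases of_nat_0_le_iff dominant_iff[OF valid])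
  qed
  also have "attached y = (\<lambda>c. \<Sum>j=1..length y. A j c - edge y j c)"
    using attached_take[of "length y" y] by auto
  finally have "0 \<le> (\<Sum>j=1..length y. ?ht (A j)) - (\<Sum>j=1..length y. ?ht (edge y j))"
    by (subst (asm) sum.swap) (simp add: sum_subtractf)
  moreover have "real (length y) \<le> (\<Sum>j=1..length y. ?ht (edge y j))"
    using sum_mono[of "{1..length y}" "\<lambda>_. 1", OF ht_edge] by simp
  moreover have "(\<Sum>j=1..length y. ?ht (A j)) \<le> (\<Sum>j=1..K. ?ht (A j))"
  proof -
    have "(\<Sum>j=1..length y. ?ht (A j)) \<le> (\<Sum>j\<in>{1..length y} \<union> {1..K}. ?ht (A j))"
      using ht_A by (intro sum_mono2) auto
    also have "\<dots> = (\<Sum>j=1..K. ?ht (A j))"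
      using added_weight_eq_0[OF assms(1)] by (intro sum.mono_neutral_right) auto
    finally show ?thesis .
  qed
  ultimately show ?thesis by linarith
qed

lemma kleber_tree_terminates:
  "\<exists>l\<ge>1. kleber_tree X L l = kleber_tree X L (l - 1)"
proof -
  obtain K where K: "\<And>b k. b \<in> N \<Longrightarrow> K \<le> k \<Longrightarrow> Lhat X L b k = 0" by (rule Lhat_eventually_zero) blast
  define H where "H = nat \<lceil>\<Sum>j=1..K. \<Sum>b\<in>N. A j b\<rceil>"
  have H: "length y \<le> H" if "branch y" for y
    using branch_length_le[of K, OF K that] unfolding H_def by linarith
  define l where "l = max K H"
  have "kleber_tree X L (Suc l) = kleber_tree X L l"
  proof
    fix y :: "weight list"
    have "A (Suc l) = (\<lambda>_. 0)" using added_weight_eq_0[of K, OF K] by (simp add: l_def)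
    moreover have "{length y<..Suc l} = insert (Suc l) {length y<..l}" if "length y \<le> l"
      using that by auto
    moreover have "length y \<le> l" if "branch y" using H[OF that] by (simp add: l_def)
    ultimately show "kleber_tree X L (Suc l) y = kleber_tree X L l y"
      unfolding kleber_tree_eq by auto
  qed
  then show ?thesis by (intro exI[of _ "Suc l"]) simp
qed

text \<open>If round \<open>M\<close> changes nothing, then the root was not shifted, so no weight is added from then on, and
  no node has depth \<open>M\<close>, so no node can acquire children later.\<close>

lemma final_tree_stable:
  obtains M where "final_tree X L = kleber_tree X L M"
    "\<And>l. M \<le> l \<Longrightarrow> kleber_tree X L l = kleber_tree X L M"
    "\<And>j. M \<le> j \<Longrightarrow> A j = (\<lambda>_. 0)"
    "\<And>y. branch y \<Longrightarrow> length y < M"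
proof -
  define M where "M = (LEAST l. l \<ge> 1 \<and> kleber_tree X L l = kleber_tree X L (l - 1))"
  have "M \<ge> 1 \<and> kleber_tree X L M = kleber_tree X L (M - 1)"
    unfolding M_def by (rule LeastI_ex) (use kleber_tree_terminates in blast)
  then obtain m where m: "M = Suc m" and stop: "kleber_tree X L (Suc m) = kleber_tree X L m"
    by (cases M) auto
  have "A (Suc m) = (\<lambda>_. 0)"
  proof
    fix c
    have "{0<..Suc m} = insert (Suc m) {0<..m}" by auto
    then show "A (Suc m) c = 0"
      using fun_cong[OF stop, of "[]"] by (auto simp: kleber_tree_eq attached_def simp del: kleber_tree.simps dest: fun_cong[of _ _ c])
  qed
  then have A0: "A j = (\<lambda>_. 0)" if "M \<le> j" for j
    using added_weight_zero_mono that m by blast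
  have len: "length y < M" if "branch y" for y
  proof (rule ccontr)
    assume "\<not> length y < M"
    then have "length (take M y) = M" by simp
    moreover have "branch (take M y)"
      using that admissible_append[of _ "take M y" "drop M y"] unfolding branch_def
      by (metis append_take_drop_id atLeastAtMost_iff length_take min.bounded_iff)
    ultimately show False
      using fun_cong[OF stop, of "take M y"] m by (simp add: kleber_tree_eq del: kleber_tree.simps)
  qed
  show ?thesis
  proof (rule that[of M])
    show "final_tree X L = kleber_tree X L M" by (simp add: final_tree_def M_def)
    show "kleber_tree X L l = kleber_tree X L M" if "M \<le> l" for l
    proof
      fix y :: "weight list"
      have "(\<Sum>j\<in>{length y<..l}. A j c) = (\<Sum>j\<in>{length y<..M}. A j c)" for c
        using that A0 by (intro sum.mono_neutral_right) auto
      then show "kleber_tree X L l y = kleber_tree X L M y"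
        unfolding kleber_tree_eq using len[of y] that by auto
    qed
  qed (use A0 len in auto)
qed

end


section \<open>Branches and configurations\<close>

lemma sum_split_at:
  fixes f :: "nat \<Rightarrow> 'a :: comm_monoid_add"
  assumes "n \<le> i"
  shows "(\<Sum>j=1..i. f j) = (\<Sum>j=1..n. f j) + (\<Sum>j\<in>{n<..i}. f j)"
proof -
  have "{1..i} = {1..n} \<union> {n<..i}" using assms by auto
  then show ?thesis by (simp only:) (rule sum.union_disjoint, auto)
qed

lemma all_nat_split:
  assumes "\<And>j. n < j \<Longrightarrow> P j"
  shows "(\<forall>j. P j) \<longleftrightarrow> (\<forall>j<n. P j) \<and> P (n :: nat)"
  using assms linorder_neqE_nat by metis

context virtual_kleber
begin

definition column :: "(nat \<Rightarrow> nat \<Rightarrow> nat) \<Rightarrow> nat \<Rightarrow> weight" where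
  "column m j = (\<lambda>b. tail (\<lambda>i. real (m b i)) j)"

definition finitely_supported :: "(nat \<Rightarrow> nat \<Rightarrow> nat) \<Rightarrow> bool" where
  "finitely_supported m \<longleftrightarrow> (\<forall>b i. b \<notin> N \<or> i = 0 \<longrightarrow> m b i = 0) \<and> finite {(b, i). m b i \<noteq> 0}"

definition partial_weight :: "(nat \<Rightarrow> nat \<Rightarrow> nat) \<Rightarrow> nat \<Rightarrow> weight" where
  "partial_weight m i = (\<lambda>c. \<Sum>j=1..i. A j c - column m j c)"

text \<open>The correspondence between configurations and names of nodes. The last conjunct excludes trailing
  zero columns and thereby determines the length of \<open>y\<close> from \<open>m\<close>.\<close>

definition represents :: "(nat \<Rightarrow> nat \<Rightarrow> nat) \<Rightarrow> weight list \<Rightarrow> bool" where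
  "represents m y \<longleftrightarrow> finitely_supported m \<and> (\<forall>j\<ge>1. edge y j = column m j) \<and>
     (\<forall>j\<in>{1..length y}. column m j \<noteq> (\<lambda>_. 0))"

lemma finitely_supported_bounded:
  assumes "finitely_supported m"
  obtains K where "\<And>b k. K \<le> k \<Longrightarrow> m b k = 0"
proof -
  have "finite (snd ` {(b, i). m b i \<noteq> 0})"
    using assms unfolding finitely_supported_def by blast
  then obtain K where "\<forall>i\<in>snd ` {(b, i). m b i \<noteq> 0}. i < K"
    using finite_nat_set_iff_bounded by blast
  then have "i < K" if "m b i \<noteq> 0" for b i using that by force
  then show ?thesis using that[of K] not_le by metis
qed

lemma column_eq:
  assumes "\<And>b k. K \<le> k \<Longrightarrow> m b k = 0"
  shows "column m j b = real (\<Sum>k\<in>{j..<K}. m b k)"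
  using assms by (simp add: column_def tail_eq[of K])

lemma column_Suc:
  assumes "finitely_supported m"
  shows "column m j b = real (m b j) + column m (Suc j) b"
proof -
  obtain K where "\<And>b k. K \<le> k \<Longrightarrow> m b k = 0"
    by (rule finitely_supported_bounded[OF assms]) blast
  then show ?thesis unfolding column_def by (intro tail_Suc[of K]) simp
qed

lemma column_nat:
  assumes "finitely_supported m"
  shows "column m j b \<in> \<nat>"
proof -
  obtain K where "\<And>b k. K \<le> k \<Longrightarrow> m b k = 0"
    by (rule finitely_supported_bounded[OF assms]) blast
  then show ?thesis by (metis column_eq of_nat_in_Nats)
qed

lemma column_in_root_cone:
  assumes "finitely_supported m"
  shows "column m j \<in> root_cone Y"
proof -
  have "column m j b = 0" if "b \<notin> N" for b
  proof -
    have "m b = (\<lambda>_. 0)" using assms that by (auto simp: finitely_supported_def)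
    then show ?thesis by (simp add: column_def tail_eq[of 0])
  qed
  then show ?thesis
    using column_nat[OF assms] by (simp add: root_cone_iff weight_space_def)
qed

lemma column_decreasing:
  assumes "finitely_supported m"
  shows "wminus (column m j) (column m (Suc j)) \<in> root_cone Y"
proof -
  have "wminus (column m j) (column m (Suc j)) = (\<lambda>b. real (m b j))"
    by (simp add: wminus_def column_Suc[OF assms, of j])
  then show ?thesis
    using assms by (simp add: root_cone_iff weight_space_def finitely_supported_def)
qed

lemma partial_weight_in_space:
  assumes "finitely_supported m"
  shows "partial_weight m i \<in> weight_space Y"
  using added_weight_in_space column_in_root_cone[OF assms]
  by (auto simp: partial_weight_def root_cone_iff weight_space_def intro!: sum.neutral)

lemma pairing_partial_weight:
  assumes "b \<in> N"
  shows "root_pairing Y (partial_weight m i) b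
    = (\<Sum>j=1..i. tail (Lh b) j - root_pairing Y (column m j) b)"
  unfolding partial_weight_def root_pairing_sum
  by (simp add: root_pairing_diff pairing_added_weight[OF assms])

text \<open>The weights \<open>min i k\<close> turn the sum over rows into a sum over the first \<open>i\<close> columns. Column \<open>j\<close> contributes
  the pairing of \<open>\<alpha>\<^sub>b\<close> with \<open>A j - d\<^sub>j\<close>.\<close>

lemma vacancy_eq:
  assumes "finitely_supported m" "b \<in> N"
  shows "vacancy X L m b i = root_pairing Y (partial_weight m i) b"
proof -
  obtain K1 where K1: "\<And>b k. K1 \<le> k \<Longrightarrow> m b k = 0"
    by (rule finitely_supported_bounded[OF assms(1)]) blast
  obtain K2 where K2: "\<And>b k. b \<in> N \<Longrightarrow> K2 \<le> k \<Longrightarrow> Lhat X L b k = 0"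
    by (rule Lhat_eventually_zero) blast
  define K where "K = max K1 K2"
  have m0: "m b k = 0" if "K \<le> k" for b k using K1 that by (simp add: K_def)
  have L0: "Lhat X L b k = 0" if "K \<le> k" for k using K2[OF assms(2)] that by (simp add: K_def)
  define f where "f k = Lh b k - (\<Sum>c\<in>N. real_of_int (cartan Y b c) * real (m c k))" for k
  have f0: "f k = 0" if "K \<le> k" for k using that by (simp add: f_def m0 L0)
  have "vacancy X L m b i = Sum_any (\<lambda>k. real (min i k) * f k)"
    unfolding vacancy_def f_def
    by (simp add: inv_form_simple_root(1)[OF assms(2)] root_pairing_simple_root)
  also have "\<dots> = (\<Sum>j=1..i. tail f j)" by (rule Sum_any_min_eq_tail[of K]) (rule f0)
  also have "\<dots> = (\<Sum>j=1..i. tail (Lh b) j - root_pairing Y (column m j) b)"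
  proof (rule sum.cong[OF refl])
    fix j
    have "tail f j = (\<Sum>k\<in>{j..<K}. f k)" by (rule tail_eq) (rule f0)
    also have "\<dots> = (\<Sum>k\<in>{j..<K}. Lh b k)
        - (\<Sum>c\<in>N. real_of_int (cartan Y b c) * (\<Sum>k\<in>{j..<K}. real (m c k)))"
      unfolding f_def sum_subtractf sum_distrib_left by (subst sum.swap) (rule refl)
    also have "\<dots> = tail (Lh b) j - root_pairing Y (column m j) b"
      by (simp add: root_pairing_def column_def tail_eq[of K] m0 L0)
    finally show "tail f j = tail (Lh b) j - root_pairing Y (column m j) b" .
  qed
  finally show ?thesis by (simp add: pairing_partial_weight[OF assms(2)])
qed

lemma pairing_partial_weight_int:
  assumes "finitely_supported m" "b \<in> N"
  shows "root_pairing Y (partial_weight m i) b \<in> \<int>"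
  unfolding pairing_partial_weight[OF assms(2)] root_pairing_def[of _ "column m _"]
  using tail_Lhat_nat[OF assms(2)] column_nat[OF assms(1)] Nats_subset_Ints
  by (intro Ints_sum Ints_diff Ints_mult) auto

text \<open>Left to right uses invertibility of the Cartan matrix: \<open>\<mu> \<circ> \<sigma> - \<mu>\<close> pairs to zero with all simple
  roots.\<close>

lemma sigma_invariant_iff:
  "(\<forall>b\<in>N. root_pairing Y \<mu> (sigma X b) = root_pairing Y \<mu> b) \<longleftrightarrow> (\<forall>b\<in>N. \<mu> (sigma X b) = \<mu> b)"
proof
  assume sym: "\<forall>b\<in>N. root_pairing Y \<mu> (sigma X b) = root_pairing Y \<mu> b"
  define \<nu> where "\<nu> c = (if c \<in> N then \<mu> (sigma X c) - \<mu> c else 0)" for c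
  have "\<nu> = (\<lambda>_. 0)"
  proof (rule weight_ext[OF valid])
    fix b assume b: "b \<in> N"
    have "root_pairing Y \<nu> b = root_pairing Y (\<lambda>c. \<mu> (sigma X c) - \<mu> c) b"
      unfolding root_pairing_def by (rule sum.cong) (simp_all add: \<nu>_def)
    then show "root_pairing Y \<nu> b = root_pairing Y (\<lambda>_. 0) b"
      using sym b root_pairing_sigma[OF valid b, of \<mu>] by (simp add: root_pairing_diff)
  qed (simp_all add: \<nu>_def weight_space_def)
  show "\<forall>b\<in>N. \<mu> (sigma X b) = \<mu> b"
  proof
    fix b assume "b \<in> N"
    then show "\<mu> (sigma X b) = \<mu> b" using fun_cong[OF \<open>\<nu> = (\<lambda>_. 0)\<close>, of b] by (simp add: \<nu>_def)
  qed
next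
  assume "\<forall>b\<in>N. \<mu> (sigma X b) = \<mu> b"
  then show "\<forall>b\<in>N. root_pairing Y \<mu> (sigma X b) = root_pairing Y \<mu> b"
    by (simp add: root_pairing_sigma[OF valid]) (simp add: root_pairing_def)
qed

lemma represents_attached:
  assumes "represents m y" "j \<le> length y"
  shows "attached (take j y) = partial_weight m j"
  using attached_take[OF assms(2)] assms(1) by (auto simp: partial_weight_def represents_def)

lemma represents_column_zero:
  assumes "represents m y" "length y < j"
  shows "column m j = (\<lambda>_. 0)"
proof -
  have "1 \<le> j" using assms(2) by simp
  then have "column m j = edge y j" using assms(1) by (simp add: represents_def)
  then show ?thesis using assms(2) by (simp add: edge_def)
qed

text \<open>The vacancy numbers are integers, so for \<open>i \<le> length y\<close> their nonnegativity is dominance of the weight at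
  depth \<open>i\<close>. Beyond the last column only weights \<open>A j\<close> with nonnegative pairings are added, so
  no further condition arises.\<close>

lemma represents_dominant_iff:
  assumes R: "represents m y"
  shows "(\<forall>b\<in>N. \<forall>i\<ge>1. 0 \<le> vacancy X L m b i) \<longleftrightarrow>
    (\<forall>j\<in>{1..length y}. attached (take j y) \<in> dominant Y)"
proof -
  have fs: "finitely_supported m" using R by (simp add: represents_def)
  have dom: "partial_weight m j \<in> dominant Y \<longleftrightarrow> (\<forall>b\<in>N. 0 \<le> vacancy X L m b j)" for j
  proof -
    have "root_pairing Y (partial_weight m j) b \<in> \<nat> \<longleftrightarrow> 0 \<le> root_pairing Y (partial_weight m j) b"
      if "b \<in> N" for b
      using pairing_partial_weight_int[OF fs that] by (auto simp: Nats_altdef2)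
    then show ?thesis
      by (simp add: dominant_iff[OF valid] partial_weight_in_space[OF fs] vacancy_eq[OF fs])
  qed
  have tail: "0 \<le> vacancy X L m b i" if b: "b \<in> N" and i: "length y < i"
    and pos: "\<forall>j\<in>{1..length y}. 0 \<le> vacancy X L m b j" for b i
  proof -
    have "vacancy X L m b i = vacancy X L m b (length y)
        + (\<Sum>j\<in>{length y<..i}. tail (Lh b) j - root_pairing Y (column m j) b)"
      unfolding vacancy_eq[OF fs b] pairing_partial_weight[OF b]
      using i by (intro sum_split_at) simp
    also have "(\<Sum>j\<in>{length y<..i}. tail (Lh b) j - root_pairing Y (column m j) b)
        = (\<Sum>j\<in>{length y<..i}. tail (Lh b) j)"
      by (rule sum.cong) (simp_all add: represents_column_zero[OF R])
    moreover have "0 \<le> (\<Sum>j\<in>{length y<..i}. tail (Lh b) j)"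
      using tail_Lhat_nat[OF b] by (intro sum_nonneg) (metis Nats_cases of_nat_0_le_iff)
    moreover have "0 \<le> vacancy X L m b (length y)"
    proof (cases "length y = 0")
      case True
      then show ?thesis by (simp add: vacancy_eq[OF fs b] partial_weight_def)
    next
      case False
      then have "length y \<in> {1..length y}" by (simp add: Suc_le_eq)
      then show ?thesis using pos by blast
    qed
    ultimately show ?thesis by simp
  qed
  show ?thesis
  proof
    assume "\<forall>b\<in>N. \<forall>i\<ge>1. 0 \<le> vacancy X L m b i"
    then show "\<forall>j\<in>{1..length y}. attached (take j y) \<in> dominant Y"
      by (simp add: represents_attached[OF R] dom)
  next
    assume "\<forall>j\<in>{1..length y}. attached (take j y) \<in> dominant Y"
    then have pos: "0 \<le> vacancy X L m b j" if "b \<in> N" "j \<in> {1..length y}" for b j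
      using that by (simp add: represents_attached[OF R] dom)
    show "\<forall>b\<in>N. \<forall>i\<ge>1. 0 \<le> vacancy X L m b i"
    proof (intro ballI allI impI)
      fix b and i :: nat assume "b \<in> N" "1 \<le> i"
      then show "0 \<le> vacancy X L m b i"
        using pos tail by (cases "i \<le> length y") auto
    qed
  qed
qed

text \<open>Invariance passes from rows to columns by taking tail sums, from the roots \<open>d\<^sub>j\<close> to their pairings
  by \<open>sigma_invariant_iff\<close>, and from there to the partial sums because the added weights are
  themselves invariant.\<close>

lemma represents_symmetric_iff:
  assumes R: "represents m y"
  shows "(\<forall>b\<in>N. \<forall>b'\<in>N. \<forall>i\<ge>1. same_orbit X b b' \<longrightarrow> m b i = m b' i) \<longleftrightarrow>
    (\<forall>j\<in>{1..length y}. \<forall>b\<in>N. root_pairing Y (attached (take j y)) (sigma X b)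
       = root_pairing Y (attached (take j y)) b)" (is "?L \<longleftrightarrow> ?R")
proof -
  have fs: "finitely_supported m" using R by (simp add: represents_def)
  let ?inv = "\<lambda>\<mu>. \<forall>b\<in>N. root_pairing Y \<mu> (sigma X b) = root_pairing Y \<mu> b"
  have step: "root_pairing Y (partial_weight m (Suc j)) b
      = root_pairing Y (partial_weight m j) b + tail (Lh b) (Suc j)
        - root_pairing Y (column m (Suc j)) b" if "b \<in> N" for b j
    by (simp add: pairing_partial_weight[OF that])
  have tail: "tail (Lh (sigma X b)) j = tail (Lh b) j" if "b \<in> N" for b j
    by (simp add: Lhat_sigma[OF that])
  note sig = sigma_maps[OF valid]
  have "?L \<longleftrightarrow> (\<forall>i\<ge>1. \<forall>b\<in>N. m (sigma X b) i = m b i)"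
    using same_orbit_invariant_iff[OF valid, of "\<lambda>b. m b _"] by blast
  also have "\<dots> \<longleftrightarrow> (\<forall>j\<ge>1. \<forall>b\<in>N. column m j (sigma X b) = column m j b)"
  proof
    assume "\<forall>i\<ge>1. \<forall>b\<in>N. m (sigma X b) i = m b i"
    moreover obtain K where "\<And>b k. K \<le> k \<Longrightarrow> m b k = 0"
      by (rule finitely_supported_bounded[OF fs]) blast
    ultimately show "\<forall>j\<ge>1. \<forall>b\<in>N. column m j (sigma X b) = column m j b"
      by (simp add: column_eq[of K])
  next
    assume "\<forall>j\<ge>1. \<forall>b\<in>N. column m j (sigma X b) = column m j b"
    then show "\<forall>i\<ge>1. \<forall>b\<in>N. m (sigma X b) i = m b i"
      using column_Suc[OF fs] by (metis add_right_cancel le_Suc_eq of_nat_eq_iff)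
  qed
  also have "\<dots> \<longleftrightarrow> (\<forall>j\<ge>1. ?inv (column m j))"
    by (simp add: sigma_invariant_iff)
  also have "\<dots> \<longleftrightarrow> (\<forall>j\<in>{1..length y}. ?inv (column m j))"
    using represents_column_zero[OF R] by (metis atLeastAtMost_iff not_le root_pairing_zero)
  also have "\<dots> \<longleftrightarrow> (\<forall>j\<in>{1..length y}. ?inv (partial_weight m j))"
  proof
    assume inv: "\<forall>j\<in>{1..length y}. ?inv (column m j)"
    have "?inv (partial_weight m j)" if "j \<le> length y" for j
      using that
    proof (induction j)
      case 0
      then show ?case by (simp add: partial_weight_def)
    next
      case (Suc j)
      then show ?case using inv by (simp add: step sig tail)
    qed
    then show "\<forall>j\<in>{1..length y}. ?inv (partial_weight m j)" by simp
  next
    assume inv: "\<forall>j\<in>{1..length y}. ?inv (partial_weight m j)"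
    have inv0: "?inv (partial_weight m j)" if "j \<le> length y" for j
    proof (cases "j = 0")
      case True
      then show ?thesis by (simp add: partial_weight_def)
    qed (use that inv in simp)
    show "\<forall>j\<in>{1..length y}. ?inv (column m j)"
    proof (intro ballI)
      fix j b assume j: "j \<in> {1..length y}" and b: "b \<in> N"
      then obtain k where k: "j = Suc k" by (cases j) auto
      show "root_pairing Y (column m j) (sigma X b) = root_pairing Y (column m j) b"
        using inv0[of k] inv0[of j] j b step[of b k] step[of "sigma X b" k] k
        by (simp add: sig tail)
    qed
  qed
  finally show ?thesis by (simp add: represents_attached[OF R])
qed

text \<open>The condition on depth or last edge from the theorem, in terms of edge labels.\<close>

definition selected :: "weight list \<Rightarrow> bool" where
  "selected y \<longleftrightarrow> gam_max X dvd length y \<or> y \<noteq> [] \<and>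
     (\<forall>a\<in>cnodes_X X. 1 < gam_max X \<and> gam_max X = gam X a \<longrightarrow>
        (\<forall>b\<in>iota X a. edge y (length y) b = 0))"

text \<open>For \<open>j \<ge> 1\<close>, \<open>m b j = 0\<close> means that the labels \<open>j\<close> and \<open>j + 1\<close> agree at \<open>b\<close>. For \<open>j < length y\<close> this is
  rule (iii) at depth \<open>j + 1\<close>, for \<open>j = length y\<close> it is the selection condition because the next
  label is zero, and for larger \<open>j\<close> it is automatic.\<close>

lemma represents_divisible_iff:
  assumes R: "represents m y"
  shows "(\<forall>a\<in>cnodes_X X. \<forall>b\<in>iota X a. \<forall>j\<ge>1. \<not> gam X a dvd j \<longrightarrow> m b j = 0) \<longleftrightarrow>
    (\<forall>j\<in>{1..length y}. \<forall>a\<in>cnodes_X X. \<not> gam X a dvd (j - 1) \<longrightarrow>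
       (\<forall>b\<in>iota X a. edge y (j - 1) b = edge y j b)) \<and> selected y" (is "?L \<longleftrightarrow> ?R \<and> _")
proof -
  have fs: "finitely_supported m" using R by (simp add: represents_def)
  have zero: "m b j = 0 \<longleftrightarrow> edge y j b = edge y (Suc j) b" if "1 \<le> j" for b j
    using R that column_Suc[OF fs, of j b] by (simp add: represents_def)
  have beyond: "edge y j = (\<lambda>_. 0)" if "length y < j" for j
    using that by (simp add: edge_def)
  let ?at = "\<lambda>j. \<forall>a\<in>cnodes_X X. \<not> gam X a dvd j \<longrightarrow> (\<forall>b\<in>iota X a. edge y j b = edge y (Suc j) b)"
  have "?L \<longleftrightarrow> (\<forall>j\<ge>1. ?at j)"
    using zero by blast
  also have "\<dots> \<longleftrightarrow> (\<forall>j. ?at j)"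
    by (metis dvd_0_right not_less_eq_eq le_zero_eq One_nat_def)
  also have "\<dots> \<longleftrightarrow> (\<forall>j<length y. ?at j) \<and> ?at (length y)"
    by (rule all_nat_split) (simp add: beyond)
  also have "(\<forall>j<length y. ?at j) \<longleftrightarrow> ?R"
  proof
    assume *: "\<forall>j<length y. ?at j"
    show ?R
    proof
      fix j assume j: "j \<in> {1..length y}"
      then obtain k where k: "j = Suc k" "k < length y" by (cases j) auto
      have "?at k" using * k(2) by blast
      then show "\<forall>a\<in>cnodes_X X. \<not> gam X a dvd (j - 1) \<longrightarrow> (\<forall>b\<in>iota X a. edge y (j - 1) b = edge y j b)"
        by (simp add: k)
    qed
  next
    assume *: ?R
    show "\<forall>j<length y. ?at j"
    proof (intro allI impI)
      fix j assume "j < length y"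
      then show "?at j" using bspec[OF *, of "Suc j"] by simp
    qed
  qed
  also have "?at (length y) \<longleftrightarrow> selected y"
  proof -
    have after: "edge y (Suc (length y)) b = 0" for b using beyond[of "Suc (length y)"] by simp
    have ndvd: "\<not> gam X a dvd length y \<longleftrightarrow> gam X a = gam_max X \<and> 1 < gam_max X \<and> \<not> gam_max X dvd length y"
      if "a \<in> cnodes_X X" for a
    proof -
      have "gam X a \<noteq> 0" by (cases X) auto
      then show ?thesis using gam_cases[OF that] by (cases "gam_max X = 1") auto
    qed
    have "?at (length y) \<longleftrightarrow> (\<forall>a\<in>cnodes_X X. gam X a = gam_max X \<and> 1 < gam_max X \<and>
        \<not> gam_max X dvd length y \<longrightarrow> (\<forall>b\<in>iota X a. edge y (length y) b = 0))"
      unfolding after by (rule ball_cong[OF refl], subst ndvd) simp_all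
    also have "\<dots> \<longleftrightarrow> selected y"
    proof (cases "gam_max X dvd length y")
      case False
      then have "y \<noteq> []" by auto
      then show ?thesis using False unfolding selected_def by metis
    qed (simp add: selected_def)
    finally show ?thesis .
  qed
  finally show ?thesis .
qed

text \<open>Of the rules for a step, the ones about the root cone hold for column heights of any configuration.\<close>

lemma represents_branch_iff:
  assumes R: "represents m y"
  shows "branch y \<longleftrightarrow>
    (\<forall>j\<in>{1..length y}. attached (take j y) \<in> dominant Y) \<and>
    (\<forall>j\<in>{1..length y}. \<forall>b\<in>N. root_pairing Y (attached (take j y)) (sigma X b)
       = root_pairing Y (attached (take j y)) b) \<and>
    (\<forall>j\<in>{1..length y}. \<forall>a\<in>cnodes_X X. \<not> gam X a dvd (j - 1) \<longrightarrow>
       (\<forall>b\<in>iota X a. edge y (j - 1) b = edge y j b))"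
proof -
  have fs: "finitely_supported m" and e: "\<And>j. 1 \<le> j \<Longrightarrow> edge y j = column m j"
    and nz: "\<And>j. j \<in> {1..length y} \<Longrightarrow> column m j \<noteq> (\<lambda>_. 0)"
    using R by (auto simp: represents_def)
  have "edge y j \<noteq> (\<lambda>_. 0) \<and> edge y j \<in> root_cone Y \<and>
      (1 < j \<longrightarrow> wminus (edge y (j - 1)) (edge y j) \<in> root_cone Y)" if j: "j \<in> {1..length y}" for j
  proof -
    have "wminus (edge y (j - 1)) (edge y j) \<in> root_cone Y" if "1 < j"
      using column_decreasing[OF fs, of "j - 1"] that by (simp add: e)
    then show ?thesis using nz[OF j] e[of j] j column_in_root_cone[OF fs] by auto
  qed
  then show ?thesis unfolding branch_def admissible_def by blast
qed

text \<open>Once \<open>J\<close> exceeds the final round and all row lengths, both sides express that the total weight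
  \<open>\<Sum>j\<le>J. A j\<close> minus all columns equals \<open>\<mu>\<close>.\<close>

lemma represents_weight_iff:
  assumes R: "represents m y" and y: "branch y"
  shows "lincomb Y (\<lambda>b. Sum_any (\<lambda>i. real i * real (m b i))) simple_root =
      wminus (lincomb Y (\<lambda>b. Sum_any (\<lambda>i. real i * Lh b i)) (fund Y)) \<mu> \<longleftrightarrow>
    wt (final_tree X L) y = \<mu>"
proof -
  have fs: "finitely_supported m" using R by (simp add: represents_def)
  obtain M where M: "final_tree X L = kleber_tree X L M"
    "\<And>j. M \<le> j \<Longrightarrow> A j = (\<lambda>_. 0)" "length y < M"
    using final_tree_stable y by metis
  obtain K1 where K1: "\<And>b k. K1 \<le> k \<Longrightarrow> m b k = 0"
    by (rule finitely_supported_bounded[OF fs]) blast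
  obtain K2 where K2: "\<And>b k. b \<in> N \<Longrightarrow> K2 \<le> k \<Longrightarrow> Lhat X L b k = 0"
    by (rule Lhat_eventually_zero) blast
  define J where "J = max M (max K1 K2)"
  have J: "K1 \<le> J" "K2 \<le> J" "M \<le> J" "length y \<le> J" using M(3) by (auto simp: J_def)
  have roots: "lincomb Y (\<lambda>b. Sum_any (\<lambda>i. real i * real (m b i))) simple_root
      = (\<lambda>c. \<Sum>j=1..J. column m j c)"
  proof
    fix c
    have "column m j c = 0" if "c \<notin> N" for j
      using column_in_root_cone[OF fs] that by (simp add: root_cone_iff weight_space_def)
    moreover have "Sum_any (\<lambda>i. real i * real (m c i)) = (\<Sum>j=1..J. column m j c)"
      unfolding column_def by (rule Sum_any_index_eq_tail[OF _ J(1)]) (simp add: K1)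
    ultimately show "lincomb Y (\<lambda>b. Sum_any (\<lambda>i. real i * real (m b i))) simple_root c
        = (\<Sum>j=1..J. column m j c)" by (simp add: lincomb_simple_root)
  qed
  have funds: "lincomb Y (\<lambda>b. Sum_any (\<lambda>i. real i * Lh b i)) (fund Y) = (\<lambda>c. \<Sum>j=1..J. A j c)"
  proof
    fix c
    have "lincomb Y (\<lambda>b. Sum_any (\<lambda>i. real i * Lh b i)) (fund Y) c
        = (\<Sum>b\<in>N. (\<Sum>j=1..J. tail (Lh b) j) * fund Y b c)"
      unfolding lincomb_def
      by (rule sum.cong[OF refl], subst Sum_any_index_eq_tail[OF _ J(2)]) (simp_all add: K2)
    also have "\<dots> = (\<Sum>j=1..J. A j c)"
      unfolding added_weight_tail lincomb_def sum_distrib_right by (rule sum.swap)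
    finally show "lincomb Y (\<lambda>b. Sum_any (\<lambda>i. real i * Lh b i)) (fund Y) c = (\<Sum>j=1..J. A j c)" .
  qed
  have "wt (final_tree X L) y = partial_weight m J"
  proof
    fix c
    have "wt (final_tree X L) y c = attached y c + (\<Sum>j\<in>{length y<..M}. A j c)"
      using M(3) y by (simp add: wt_def M(1) kleber_tree_eq)
    also have "(\<Sum>j\<in>{length y<..M}. A j c) = (\<Sum>j\<in>{length y<..J}. A j c - column m j c)"
      using J(3) M(2) represents_column_zero[OF R]
      by (intro sum.mono_neutral_cong_left) auto
    also have "attached y = partial_weight m (length y)"
      using represents_attached[OF R, of "length y"] by simp
    finally show "wt (final_tree X L) y c = partial_weight m J c"
      unfolding partial_weight_def sum_split_at[OF J(4)] .
  qed
  then show ?thesis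
    unfolding roots funds wminus_def partial_weight_def fun_eq_iff sum_subtractf
    by (intro iff_allI) auto
qed

definition selected_nodes :: "weight \<Rightarrow> weight list set" where
  "selected_nodes \<mu> = {y \<in> dom (final_tree X L). wt (final_tree X L) y = \<mu> \<and>
     (good_depth X y \<or> good_edge X (final_tree X L) y)}"

lemma selected_nodes_iff:
  "y \<in> selected_nodes \<mu> \<longleftrightarrow> branch y \<and> wt (final_tree X L) y = \<mu> \<and> selected y"
proof -
  obtain M where M: "final_tree X L = kleber_tree X L M" "\<And>y. branch y \<Longrightarrow> length y < M"
    using final_tree_stable by metis
  have dom: "y \<in> dom (final_tree X L) \<longleftrightarrow> branch y"
    using M(2)[of y] by (auto simp: M(1) dom_def kleber_tree_eq)
  have "edge_diff (final_tree X L) (butlast y) y = edge y (length y)" if y: "branch y" "y \<noteq> []"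
  proof -
    obtain k where k: "length y = Suc k" using y(2) by (cases y) auto
    have "y = butlast y @ [last y]" using y(2) by simp
    then have y': "branch (butlast y)" using y(1) branch_snoc by metis
    have "{k<..M} = insert (Suc k) {Suc k<..M}" using M(2)[OF y(1)] k by auto
    then have "wt (final_tree X L) (butlast y)
        = (\<lambda>c. attached (butlast y) c + A (Suc k) c + (\<Sum>j\<in>{Suc k<..M}. A j c))"
      using M(2)[OF y(1)] y' k by (simp add: wt_def M(1) kleber_tree_eq add.assoc)
    moreover have "wt (final_tree X L) y = (\<lambda>c. attached y c + (\<Sum>j\<in>{Suc k<..M}. A j c))"
      using M(2)[OF y(1)] y(1) k by (simp add: wt_def M(1) kleber_tree_eq)
    moreover have "take k y = butlast y" using k by (simp add: butlast_conv_take)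
    ultimately show ?thesis using k by (simp add: edge_diff_def edge_def wminus_def)
  qed
  then have "good_edge X (final_tree X L) y \<longleftrightarrow> y \<noteq> [] \<and>
     (\<forall>a\<in>cnodes_X X. 1 < gam_max X \<and> gam_max X = gam X a \<longrightarrow>
        (\<forall>b\<in>iota X a. edge y (length y) b = 0))" if "branch y"
    using that unfolding good_edge_def
    by (auto simp: inv_form_fund[OF valid] iota_subset[OF valid])
  then show ?thesis
    unfolding selected_nodes_def selected_def good_depth_def mem_Collect_eq dom by blast
qed

lemma represents_config_iff:
  assumes R: "represents m y"
  shows "m \<in> virtual_configs X L lam \<longleftrightarrow> y \<in> selected_nodes (Psi X lam)"
proof -
  have fs: "finitely_supported m" using R by (simp add: represents_def)
  have "m \<in> virtual_configs X L lam \<longleftrightarrow> branch y \<and> selected y \<and>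
      lincomb Y (\<lambda>b. Sum_any (\<lambda>i. real i * real (m b i))) simple_root =
        wminus (lincomb Y (\<lambda>b. Sum_any (\<lambda>i. real i * Lh b i)) (fund Y)) (Psi X lam)"
    using fs unfolding virtual_configs_def mem_Collect_eq represents_dominant_iff[OF R]
      represents_symmetric_iff[OF R] represents_divisible_iff[OF R] represents_branch_iff[OF R]
      finitely_supported_def
    by argo
  then show ?thesis
    using represents_weight_iff[OF R] unfolding selected_nodes_iff by blast
qed

text \<open>The upper bound is the number of nonzero columns of \<open>m\<close>, i.e. its largest row length.\<close>

definition branch_of :: "(nat \<Rightarrow> nat \<Rightarrow> nat) \<Rightarrow> weight list" where
  "branch_of m = map (\<lambda>j. partial_weight m (Suc j)) [0..<LEAST n. \<forall>b i. n < i \<longrightarrow> m b i = 0]"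

text \<open>For the labels of a branch the differences of consecutive column heights are nonnegative integers,
  so the truncation is exact.\<close>

definition config_of :: "weight list \<Rightarrow> nat \<Rightarrow> nat \<Rightarrow> nat" where
  "config_of y b i = (if i = 0 then 0 else nat \<lfloor>edge y i b - edge y (Suc i) b\<rfloor>)"

lemma represents_branch_of:
  assumes fs: "finitely_supported m"
  shows "represents m (branch_of m)"
proof -
  define n where "n = (LEAST n. \<forall>b i. n < i \<longrightarrow> m b i = 0)"
  obtain K where K: "\<And>b k. K \<le> k \<Longrightarrow> m b k = 0"
    by (rule finitely_supported_bounded[OF fs]) blast
  have "\<forall>b i. n < i \<longrightarrow> m b i = 0"
    unfolding n_def by (rule LeastI[of _ K]) (simp add: K)
  then have n: "m b i = 0" if "n < i" for b i using that by blast
  have len: "length (branch_of m) = n" by (simp add: branch_of_def n_def)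
  have att: "attached (take j (branch_of m)) = partial_weight m j" if "j \<le> n" for j
  proof (cases j)
    case 0
    then show ?thesis by (simp add: attached_def partial_weight_def)
  next
    case (Suc k)
    then have "take j (branch_of m) \<noteq> []" using that len by (cases "branch_of m") auto
    moreover have "last (take j (branch_of m)) = branch_of m ! k"
      using that len Suc by (simp add: take_Suc_conv_app_nth)
    ultimately show ?thesis
      using that Suc len by (simp add: attached_def branch_of_def n_def)
  qed
  have "edge (branch_of m) j = column m j" if "1 \<le> j" for j
  proof (cases "j \<le> n")
    case True
    obtain k where "j = Suc k" using \<open>1 \<le> j\<close> by (cases j) auto
    then show ?thesis
      using True by (simp add: edge_def len att wminus_def partial_weight_def)
  next
    case False
    then have "column m j b = 0" for b
      by (subst column_eq[of "Suc n"]) (auto simp: n)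
    then show ?thesis using False by (simp add: edge_def len fun_eq_iff)
  qed
  moreover have "column m j \<noteq> (\<lambda>_. 0)" if "j \<in> {1..n}" for j
  proof -
    have "\<not> (\<forall>b i. n - 1 < i \<longrightarrow> m b i = 0)"
      using not_less_Least[of "n - 1" "\<lambda>n. \<forall>b i. n < i \<longrightarrow> m b i = 0"] that by (auto simp: n_def)
    then obtain b i where "n - 1 < i" "m b i \<noteq> 0" by blast
    then have "m b n \<noteq> 0" using n[of i b] by (cases "i = n") (auto simp: not_less)
    moreover have "m b n \<le> (\<Sum>k\<in>{j..<Suc n}. m b k)"
      using that by (intro member_le_sum) auto
    ultimately have "column m j b \<noteq> 0"
      by (subst column_eq[of "Suc n"]) (auto simp: n)
    then show ?thesis by (metis)
  qed
  ultimately show ?thesis using fs len by (simp add: represents_def)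
qed

lemma represents_config_of:
  assumes y: "branch y"
  shows "represents (config_of y) y"
proof -
  have real_config: "real (config_of y b i) = edge y i b - edge y (Suc i) b" if "1 \<le> i" for b i
  proof -
    have cone: "wminus (edge y i) (edge y (Suc i)) \<in> root_cone Y"
      using branch_edge_decreasing[OF y that] .
    have "edge y i b - edge y (Suc i) b \<in> \<nat>"
      using cone by (cases "b \<in> N") (auto simp: root_cone_iff wminus_def weight_space_def)
    then obtain k where k: "edge y i b - edge y (Suc i) b = real k" by (rule Nats_cases)
    show ?thesis unfolding config_of_def k using that by simp
  qed
  have beyond: "edge y j = (\<lambda>_. 0)" if "length y < j" for j
    using that by (simp add: edge_def)
  have zero: "config_of y b k = 0" if "Suc (length y) \<le> k" for b k
    using that by (simp add: config_of_def beyond)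
  have "config_of y b i = 0" if "b \<notin> N" for b i
    using branch_edge_decreasing[OF y, of i] that
    by (cases "i = 0") (auto simp: config_of_def root_cone_iff wminus_def weight_space_def)
  moreover have "finite {(b, i). config_of y b i \<noteq> 0}"
  proof (rule finite_subset)
    show "{(b, i). config_of y b i \<noteq> 0} \<subseteq> N \<times> {..length y}"
      using calculation zero by (auto simp: not_less_eq_eq[symmetric] intro: ccontr)
  qed (simp add: finite_cnodes_Y)
  ultimately have "finitely_supported (config_of y)"
    by (auto simp: finitely_supported_def config_of_def[of _ _ 0])
  moreover have col: "column (config_of y) j = edge y j" if j: "1 \<le> j" for j
  proof
    fix b
    show "column (config_of y) j b = edge y j b"
    proof (cases "j \<le> Suc (length y)")
      case True
      have "column (config_of y) j b = (\<Sum>k\<in>{j..<Suc (length y)}. real (config_of y b k))"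
        using zero by (simp add: column_eq[of "Suc (length y)"])
      also have "\<dots> = (\<Sum>k\<in>{j..<Suc (length y)}. - edge y (Suc k) b - - edge y k b)"
        by (rule sum.cong) (use j in \<open>auto simp: real_config\<close>)
      also have "\<dots> = edge y j b"
        using sum_Suc_diff'[OF True, of "\<lambda>k. - edge y k b"] beyond[of "Suc (length y)"] by simp
      finally show ?thesis .
    next
      case False
      then show ?thesis using zero by (simp add: column_eq[of "Suc (length y)"] beyond)
    qed
  qed
  moreover have "column (config_of y) j \<noteq> (\<lambda>_. 0)" if "j \<in> {1..length y}" for j
    using y that col by (auto simp: branch_def admissible_def)
  ultimately show ?thesis by (simp add: represents_def)
qed

lemma represents_unique_config:
  assumes "represents m y" "represents m' y"
  shows "m = m'"
proof (intro ext)
  fix b i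
  show "m b i = m' b i"
  proof (cases "i = 0")
    case True
    then show ?thesis using assms by (simp add: represents_def finitely_supported_def)
  next
    case False
    then have "column m i b = column m' i b" "column m (Suc i) b = column m' (Suc i) b"
      using assms by (auto simp: represents_def simp flip: One_nat_def)
    then show ?thesis
      using column_Suc[of m i b] column_Suc[of m' i b] assms by (simp add: represents_def)
  qed
qed

lemma represents_unique_branch:
  assumes "represents m y" "represents m y'"
  shows "y = y'"
proof -
  have le: "length z \<le> length z'" if "represents m z" "represents m z'" for z z'
  proof (rule ccontr)
    assume less: "\<not> length z \<le> length z'"
    then have "length z \<in> {1..length z}" by auto
    then show False
      using that(1) represents_column_zero[OF that(2), of "length z"] less
      by (auto simp: represents_def)
  qed
  have len: "length y = length y'"
    using le[OF assms] le[OF assms(2,1)] by simp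
  have nth: "z ! k = partial_weight m (Suc k)" if "represents m z" "k < length z" for z k
  proof -
    have "attached (take (Suc k) z) = z ! k"
      using that(2) by (simp add: attached_def take_Suc_conv_app_nth)
    then show ?thesis using represents_attached[OF that(1), of "Suc k"] that(2) by simp
  qed
  show ?thesis
    by (rule nth_equalityI[OF len]) (use nth assms len in simp)
qed

lemma bij_betw_branch_of:
  "bij_betw branch_of (virtual_configs X L lam) (selected_nodes (Psi X lam))"
proof -
  have rep: "represents m (branch_of m)" if "m \<in> virtual_configs X L lam" for m
    using that by (intro represents_branch_of) (auto simp: virtual_configs_def finitely_supported_def)
  show ?thesis
  proof (rule bij_betw_imageI)
    show "inj_on branch_of (virtual_configs X L lam)"
      using rep represents_unique_config by (metis inj_onI)
    show "branch_of ` virtual_configs X L lam = selected_nodes (Psi X lam)"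
    proof (intro equalityI subsetI)
      fix y assume "y \<in> branch_of ` virtual_configs X L lam"
      then show "y \<in> selected_nodes (Psi X lam)" using rep represents_config_iff by blast
    next
      fix y assume y: "y \<in> selected_nodes (Psi X lam)"
      then have R: "represents (config_of y) y"
        using represents_config_of selected_nodes_iff by blast
      then have m: "config_of y \<in> virtual_configs X L lam"
        using represents_config_iff y by blast
      moreover have "branch_of (config_of y) = y"
        using represents_unique_branch[OF rep[OF m] R] .
      ultimately show "y \<in> branch_of ` virtual_configs X L lam" by force
    qed
  qed
qed

end

theorem mainTheorem9:
  fixes X :: xtype and L :: "nat \<Rightarrow> nat \<Rightarrow> nat" and lam :: "nat \<Rightarrow> int"
  assumes "valid_X X"
    and "finite {(a, i). a \<in> cnodes_X X \<and> 1 \<le> i \<and> L a i \<noteq> 0}"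
    and "lam \<in> dominant_X X"
  shows "\<exists>f. bij_betw f (virtual_configs X L lam)
           {y \<in> dom (final_tree X L).
              wt (final_tree X L) y = Psi X lam \<and>
              (good_depth X y \<or> good_edge X (final_tree X L) y)}"
proof -
  interpret virtual_kleber X L
    by unfold_locales (fact assms)+
  show ?thesis
    using bij_betw_branch_of unfolding selected_nodes_def by blast
qed

end
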